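(* Let $\phi:N^2\to\mathbb{R}^3$ be a positive definite elliptic or hyperbolic affine sphere with mean curvature $\varepsilon_1=\pm1$ and affine normal $-\varepsilon_1\phi$, and let $\gamma=(\gamma_1,\gamma_2):I\to\mathbb{R}^2$ be a curve such that $\varphi:I\times N^2\to\mathbb{R}^4$, $\varphi(t,v,w)=(\gamma_1(t),\gamma_2(t)\phi(v,w))$, defines a 3-dimensional indefinite affine hypersphere. Then $\varphi(I\times N^2)$ admits a pointwise $\mathbb{Z}_3$- or $SO(2)$-symmetry.
   Context: $D$ is the flat connection and $\det$ the volume form of $\mathbb{R}^{n+1}$. For a nondegenerate immersed hypersurface $\varphi:M^n\to\mathbb{R}^{n+1}$ the affine (Blaschke) normal $\xi$ is the transverse vector field, unique up to sign, such that (identifying tangent vectors with their images under $\varphi_*$) $D_XY=\nabla_XY+h(X,Y)\xi$, $D_X\xi=-SX$ with $SX$ tangential, and the volume form $\det(\varphi_*X_1,\dots,\varphi_*X_n,\xi)$ equals (up to orientation) the volume form $|\det h|^{1/2}$ of $h$. $\nabla$ is the induced connection, $h$ the affine metric, $S$ the shape operator, $\widehat\nabla$ the Levi-Civita connection of $h$, and $K(X,Y)=\nabla_XY-\widehat\nabla_XY$ the difference tensor. $\varphi$ is an affine (hyper)sphere if $S=H\,\mathrm{Id}$ with $H$ constant (the mean curvature); it is proper if $H\neq0$, improper if $H=0$, indefinite if $h$ is indefinite. A 2-dimensional affine sphere in $\mathbb{R}^3$ is positive definite if (for a suitable sign of $\xi$) $h$ is positive definite, and is then elliptic if $H>0$ and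 hyperbolic if $H<0$. For $n=3$ and $h$ indefinite, the sign of $\xi$ is fixed so that $h$ has exactly one negative direction. $M^3$ admits a pointwise $G$-symmetry if for every $p\in M$ there is a subgroup of the isometry group $SO(1,2)$ of $(T_pM,h)$, isomorphic to $G$, all of whose elements $L$ satisfy $K(LX_p,LY_p)=L(K(X_p,Y_p))$ for all $X_p,Y_p\in T_pM$. "Admits a pointwise $\mathbb{Z}_3$- or $SO(2)$-symmetry" means that at every point such a subgroup isomorphic to $\mathbb{Z}_3$ or to $SO(2)$ exists. *)

theory Defs
  imports "HOL-Analysis.Analysis" "HOL-Algebra.Elementary_Groups"
begin

section \<open>Smooth maps and smooth manifolds\<close>

text \<open>\<open>C_on k U f\<close>: on the open set \<open>U\<close> the map \<open>f\<close> is of class \<open>C^k\<close>, phrased through iterated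
  directional derivatives; on finite-dimensional domains this is the usual notion.\<close>

primrec C_on :: "nat \<Rightarrow> 'a::real_normed_vector set \<Rightarrow> ('a \<Rightarrow> 'b::real_normed_vector) \<Rightarrow> bool" where
  "C_on 0 U f \<longleftrightarrow> continuous_on U f"
| "C_on (Suc k) U f \<longleftrightarrow> (\<forall>u\<in>U. f differentiable (at u)) \<and>
     (\<forall>v. C_on k U (\<lambda>u. frechet_derivative f (at u) v))"

definition smooth_on :: "'a::real_normed_vector set \<Rightarrow> ('a \<Rightarrow> 'b::real_normed_vector) \<Rightarrow> bool" where
  "smooth_on U f \<longleftrightarrow> (\<forall>k. C_on k U f)"

text \<open>Charts are local parametrizations \<open>(U, x)\<close>, with \<open>x\<close> going from \<open>U\<close> in \<open>\<real>^n\<close> to the manifold.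
  The carrier of the manifold is \<open>topspace T\<close>.\<close>

type_synonym ('n, 'p) chart = "(real^'n) set \<times> (real^'n \<Rightarrow> 'p)"

definition smooth_manifold :: "'p topology \<Rightarrow> ('n::finite, 'p) chart set \<Rightarrow> bool" where
  "smooth_manifold T A \<longleftrightarrow>
     Hausdorff_space T \<and> second_countable T \<and>
     (\<forall>(U, x)\<in>A. open U \<and> openin T (x ` U) \<and>
        homeomorphic_map (top_of_set U) (subtopology T (x ` U)) x) \<and>
     (\<Union>(U, x)\<in>A. x ` U) = topspace T \<and>
     (\<forall>(U, x)\<in>A. \<forall>(V, y)\<in>A. smooth_on {u \<in> U. x u \<in> y ` V} (\<lambda>u. inv_into V y (x u)))"

text \<open>The product atlas on \<open>I \<times> N\<close>, for an open interval \<open>I\<close> and a surface \<open>N\<close> with atlas \<open>A\<close>.\<close>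

definition pr23 :: "real^3 \<Rightarrow> real^2" where
  "pr23 u = vector [u $ 2, u $ 3]"

definition interval_times_atlas :: "real set \<Rightarrow> (2, 'p) chart set \<Rightarrow> (3, real \<times> 'p) chart set" where
  "interval_times_atlas I A =
     (\<lambda>(U, x). ({u. u $ 1 \<in> I \<and> pr23 u \<in> U}, \<lambda>u. (u $ 1, x (pr23 u)))) ` A"


section \<open>Hypersurfaces in a local parametrization\<close>

text \<open>In this section \<open>F\<close> is a parametrized hypersurface, defined on an open set \<open>U\<close> of \<open>\<real>^n\<close>.
  Vector fields on \<open>U\<close> are maps \<open>\<real>^n \<rightarrow> \<real>^n\<close>, of which only the values on \<open>U\<close> matter, and
  \<open>\<real>^n\<close> is the tangent space at every point \<open>u\<close>.\<close>

definition push :: "(real^'n \<Rightarrow> real^'m) \<Rightarrow> (real^'n \<Rightarrow> real^'n) \<Rightarrow> real^'n \<Rightarrow> real^'m" where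
  "push F Y u = frechet_derivative F (at u) (Y u)"

definition dir_deriv ::
    "(real^'n \<Rightarrow> real^'n) \<Rightarrow> (real^'n \<Rightarrow> 'b::real_normed_vector) \<Rightarrow> real^'n \<Rightarrow> 'b" where
  "dir_deriv X V u = frechet_derivative V (at u) (X u)"

definition immersed_hypersurface :: "(real^'n) set \<Rightarrow> (real^'n \<Rightarrow> real^'m) \<Rightarrow> bool" where
  "immersed_hypersurface U F \<longleftrightarrow> CARD('m) = CARD('n) + 1 \<and> open U \<and> smooth_on U F \<and>
     (\<forall>u\<in>U. inj (frechet_derivative F (at u)))"

text \<open>The two components of the Gauss formula \<open>D_X(F_* Y) = F_*(\<nabla>_X Y) + h(X,Y) \<xi>\<close>. Since \<open>h\<close> is
  tensorial, \<open>h(a,b)\<close> at \<open>u\<close> may be computed by extending \<open>a\<close>, \<open>b\<close> to constant vector fields.\<close>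

definition induced_connection ::
    "(real^'n \<Rightarrow> real^'m) \<Rightarrow> (real^'n \<Rightarrow> real^'m) \<Rightarrow>
     (real^'n \<Rightarrow> real^'n) \<Rightarrow> (real^'n \<Rightarrow> real^'n) \<Rightarrow> real^'n \<Rightarrow> real^'n" where
  "induced_connection F \<xi> X Y u =
     (THE z. \<exists>c. dir_deriv X (push F Y) u = frechet_derivative F (at u) z + c *\<^sub>R \<xi> u)"

definition affine_metric ::
    "(real^'n \<Rightarrow> real^'m) \<Rightarrow> (real^'n \<Rightarrow> real^'m) \<Rightarrow> real^'n \<Rightarrow> real^'n \<Rightarrow> real^'n \<Rightarrow> real" where
  "affine_metric F \<xi> u a b =
     (THE c. \<exists>z. dir_deriv (\<lambda>_. a) (push F (\<lambda>_. b)) u = frechet_derivative F (at u) z + c *\<^sub>R \<xi> u)"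

definition shape_operator ::
    "(real^'n \<Rightarrow> real^'m) \<Rightarrow> (real^'n \<Rightarrow> real^'m) \<Rightarrow> real^'n \<Rightarrow> real^'n \<Rightarrow> real^'n" where
  "shape_operator F \<xi> u a =
     (THE z. dir_deriv (\<lambda>_. a) \<xi> u = - frechet_derivative F (at u) z)"

definition nondegenerate_form :: "('v::real_vector \<Rightarrow> 'v \<Rightarrow> real) \<Rightarrow> bool" where
  "nondegenerate_form g \<longleftrightarrow> (\<forall>a. (\<forall>b. g a b = 0) \<longrightarrow> a = 0)"

definition positive_definite_form :: "('v::real_vector \<Rightarrow> 'v \<Rightarrow> real) \<Rightarrow> bool" where
  "positive_definite_form g \<longleftrightarrow> (\<forall>a. a \<noteq> 0 \<longrightarrow> g a a > 0)"

definition indefinite_form :: "('v::real_vector \<Rightarrow> 'v \<Rightarrow> real) \<Rightarrow> bool" where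
  "indefinite_form g \<longleftrightarrow> (\<exists>a. g a a > 0) \<and> (\<exists>a. g a a < 0)"

definition negative_index :: "('v::euclidean_space \<Rightarrow> 'v \<Rightarrow> real) \<Rightarrow> nat" where
  "negative_index g = Max {dim W | W. subspace W \<and> (\<forall>w\<in>W. w \<noteq> 0 \<longrightarrow> g w w < 0)}"

text \<open>The square matrix with rows \<open>V i\<close> and \<open>\<nu>\<close>, where the rows \<open>V i\<close> are put in the positions
  \<open>e i\<close>. For \<open>CARD('m) = CARD('n) + 1\<close> and injective \<open>e\<close> exactly one position is left for \<open>\<nu>\<close>, and
  the determinant does not depend on \<open>e\<close> up to sign.\<close>

definition frame_matrix :: "('n \<Rightarrow> 'm) \<Rightarrow> ('n \<Rightarrow> real^'m) \<Rightarrow> real^'m \<Rightarrow> real^'m^'m" where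
  "frame_matrix e V \<nu> = (\<chi> i. if i \<in> range e then V (the_inv e i) else \<nu>)"

definition affine_normal ::
    "(real^'n) set \<Rightarrow> (real^'n \<Rightarrow> real^'m) \<Rightarrow> (real^'n \<Rightarrow> real^'m) \<Rightarrow> bool" where
  "affine_normal U F \<xi> \<longleftrightarrow> smooth_on U \<xi> \<and>
     (\<forall>u\<in>U. \<xi> u \<notin> range (frechet_derivative F (at u)) \<and>
        (\<forall>a. dir_deriv (\<lambda>_. a) \<xi> u \<in> range (frechet_derivative F (at u))) \<and>
        nondegenerate_form (affine_metric F \<xi> u) \<and>
        (\<forall>(X :: 'n \<Rightarrow> real^'n) (e :: 'n \<Rightarrow> 'm). inj e \<longrightarrow>
           \<bar>det (frame_matrix e (\<lambda>i. frechet_derivative F (at u) (X i)) (\<xi> u))\<bar> =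
           sqrt \<bar>det (\<chi> i j. affine_metric F \<xi> u (X i) (X j))\<bar>))"


subsection \<open>Levi-Civita connection and difference tensor\<close>

definition connection_on ::
    "(real^'n) set \<Rightarrow>
     ((real^'n \<Rightarrow> real^'n) \<Rightarrow> (real^'n \<Rightarrow> real^'n) \<Rightarrow> real^'n \<Rightarrow> real^'n) \<Rightarrow> bool" where
  "connection_on U N \<longleftrightarrow>
     (\<forall>X Y Z f. smooth_on U X \<and> smooth_on U Y \<and> smooth_on U Z \<and> smooth_on U f \<longrightarrow>
        smooth_on U (N X Y) \<and>
        (\<forall>u\<in>U. N (\<lambda>v. X v + Y v) Z u = N X Z u + N Y Z u \<and>
           N (\<lambda>v. f v *\<^sub>R X v) Z u = f u *\<^sub>R N X Z u \<and>
           N X (\<lambda>v. Y v + Z v) u = N X Y u + N X Z u \<and>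
           N X (\<lambda>v. f v *\<^sub>R Y v) u = f u *\<^sub>R N X Y u + dir_deriv X f u *\<^sub>R Y u))"

definition lie_bracket ::
    "(real^'n \<Rightarrow> real^'n) \<Rightarrow> (real^'n \<Rightarrow> real^'n) \<Rightarrow> real^'n \<Rightarrow> real^'n" where
  "lie_bracket X Y u = dir_deriv X Y u - dir_deriv Y X u"

definition is_levi_civita ::
    "(real^'n) set \<Rightarrow> (real^'n \<Rightarrow> real^'n \<Rightarrow> real^'n \<Rightarrow> real) \<Rightarrow>
     ((real^'n \<Rightarrow> real^'n) \<Rightarrow> (real^'n \<Rightarrow> real^'n) \<Rightarrow> real^'n \<Rightarrow> real^'n) \<Rightarrow> bool" where
  "is_levi_civita U g N \<longleftrightarrow> connection_on U N \<and>
     (\<forall>X Y Z. smooth_on U X \<and> smooth_on U Y \<and> smooth_on U Z \<longrightarrow>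
        (\<forall>u\<in>U. N X Y u - N Y X u = lie_bracket X Y u \<and>
           dir_deriv X (\<lambda>v. g v (Y v) (Z v)) u = g u (N X Y u) (Z u) + g u (Y u) (N X Z u)))"

text \<open>The choice is immaterial: for smooth nondegenerate symmetric \<open>g\<close> such an operator exists, and
  on smooth vector fields its values on \<open>U\<close> are unique.\<close>

definition levi_civita ::
    "(real^'n) set \<Rightarrow> (real^'n \<Rightarrow> real^'n \<Rightarrow> real^'n \<Rightarrow> real) \<Rightarrow>
     (real^'n \<Rightarrow> real^'n) \<Rightarrow> (real^'n \<Rightarrow> real^'n) \<Rightarrow> real^'n \<Rightarrow> real^'n" where
  "levi_civita U g = (SOME N. is_levi_civita U g N)"

text \<open>Being tensorial, \<open>K(a,b) = \<nabla>_a b - \<nabla>^_a b\<close> may be computed on constant extensions.\<close>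

definition difference_tensor ::
    "(real^'n) set \<Rightarrow> (real^'n \<Rightarrow> real^'m) \<Rightarrow> (real^'n \<Rightarrow> real^'m) \<Rightarrow>
     real^'n \<Rightarrow> real^'n \<Rightarrow> real^'n \<Rightarrow> real^'n" where
  "difference_tensor U F \<xi> u a b =
     induced_connection F \<xi> (\<lambda>_. a) (\<lambda>_. b) u - levi_civita U (affine_metric F \<xi>) (\<lambda>_. a) (\<lambda>_. b) u"


section \<open>Affine hyperspheres and pointwise symmetries on manifolds\<close>

text \<open>\<open>f\<close> is an affine hypersphere with affine normal \<open>\<xi>\<close> and mean curvature \<open>H\<close>. All conditions are
  invariant under a change of chart.\<close>

definition affine_hypersphere ::
    "('n::finite, 'p) chart set \<Rightarrow> ('p \<Rightarrow> real^'m) \<Rightarrow> ('p \<Rightarrow> real^'m) \<Rightarrow> real \<Rightarrow> bool" where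
  "affine_hypersphere A f \<xi> H \<longleftrightarrow>
     (\<forall>(U, x)\<in>A. immersed_hypersurface U (f \<circ> x) \<and> affine_normal U (f \<circ> x) (\<xi> \<circ> x) \<and>
        (\<forall>u\<in>U. \<forall>a. shape_operator (f \<circ> x) (\<xi> \<circ> x) u a = H *\<^sub>R a))"

definition metric_satisfies ::
    "('n::finite, 'p) chart set \<Rightarrow> ('p \<Rightarrow> real^'m) \<Rightarrow> ('p \<Rightarrow> real^'m) \<Rightarrow>
     ((real^'n \<Rightarrow> real^'n \<Rightarrow> real) \<Rightarrow> bool) \<Rightarrow> bool" where
  "metric_satisfies A f \<xi> P \<longleftrightarrow>
     (\<forall>(U, x)\<in>A. \<forall>u\<in>U. P (affine_metric (f \<circ> x) (\<xi> \<circ> x) u))"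

definition special_isometry_group ::
    "(real^'n \<Rightarrow> real^'n \<Rightarrow> real) \<Rightarrow> (real^'n \<Rightarrow> real^'n) monoid" where
  "special_isometry_group g =
     \<lparr>carrier = {L. linear L \<and> (\<forall>a b. g (L a) (L b) = g a b) \<and> det (matrix L) = 1},
      mult = (\<circ>), one = id\<rparr>"

definition SO2 :: "(real^2 \<Rightarrow> real^2) monoid" where
  "SO2 = special_isometry_group (\<bullet>)"

text \<open>The tangent space at \<open>p\<close> is identified with \<open>\<real>^n\<close> by a chart around \<open>p\<close>; by naturality
  it does not matter which one.\<close>

definition symmetric_at ::
    "('n::finite, 'p) chart set \<Rightarrow> ('p \<Rightarrow> real^'m) \<Rightarrow> ('p \<Rightarrow> real^'m) \<Rightarrow> 'g monoid \<Rightarrow> 'p \<Rightarrow> bool" where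
  "symmetric_at A f \<xi> G p \<longleftrightarrow>
     (\<exists>(U, x)\<in>A. \<exists>u\<in>U. x u = p \<and>
        (let SO = special_isometry_group (affine_metric (f \<circ> x) (\<xi> \<circ> x) u);
             K = difference_tensor U (f \<circ> x) (\<xi> \<circ> x) u
         in \<exists>S. subgroup S SO \<and> SO\<lparr>carrier := S\<rparr> \<cong> G \<and>
              (\<forall>L\<in>S. \<forall>a b. K (L a) (L b) = L (K a b))))"

text \<open>The hypersurface \<open>(\<gamma>\<^sub>1(t), \<gamma>\<^sub>2(t) \<phi>(q))\<close>.\<close>

definition warped_hypersurface :: "(real \<Rightarrow> real^2) \<Rightarrow> ('p \<Rightarrow> real^3) \<Rightarrow> real \<times> 'p \<Rightarrow> real^4" where
  "warped_hypersurface \<gamma> \<phi> = (\<lambda>(t, q).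
     vector [\<gamma> t $ 1, \<gamma> t $ 2 * \<phi> q $ 1, \<gamma> t $ 2 * \<phi> q $ 2, \<gamma> t $ 2 * \<phi> q $ 3])"

end

theory Submission
  imports Defs
begin

text \<open>If \<open>\<nu>\<close> is the conormal of an affine hypersurface \<open>F\<close>, normalized by \<open>\<nu> \<bullet> \<xi> = 1\<close>, then
  \<open>h(a,b) = \<nu> \<bullet> D\<^sup>2F(a,b)\<close>, and \<open>-2 h(K(a,b),c)\<close> is the totally symmetric cubic form
  \<open>\<nu> \<bullet> D\<^sup>3F(a,b,c) + D\<nu>(a) \<bullet> D\<^sup>2F(b,c) + D\<nu>(b) \<bullet> D\<^sup>2F(a,c) + D\<nu>(c) \<bullet> D\<^sup>2F(a,b)\<close>. For the warped
  hypersurface the conormal is \<open>(\<gamma>\<^sub>2', \<epsilon> \<gamma>\<^sub>1' n) / s\<close>, with \<open>n\<close> the conormal of the surface, and the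
  volume condition shows that \<open>s\<close> depends on \<open>t\<close> only. Hence the metric is a warped product, and the
  cubic form is \<open>A a\<^sub>1 b\<^sub>1 c\<^sub>1 + B (a\<^sub>1 h\<^sub>2(b,c) + b\<^sub>1 h\<^sub>2(a,c) + c\<^sub>1 h\<^sub>2(a,b))\<close> plus a multiple of the cubic
  form of the surface. The latter is trace-free by apolarity, so it is invariant under the rotation by
  \<open>2\<pi>/3\<close> in the tangent plane of the surface: the symmetry group \<open>\<int>\<^sub>3\<close> always exists, and \<open>SO(2)\<close>
  only appears as the larger group at the points where the cubic form of the surface vanishes.\<close>

section \<open>Calculus of smooth maps\<close>

text \<open>On a Euclidean plane with linear complex coordinate z, a trace-free symmetric cubic form
  is the real part of c z^3; this is why it does not notice a third of a turn. Passing from K to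
  h(K(a,b),c) turns equivariance of K into invariance of a polynomial, with no loss because h is
  nondegenerate. The shape of the conormal comes from the affine normal of the surface being a
  multiple of the position vector: n \<bullet> \<phi> is then the constant -\<epsilon>, so the
  velocity (\<gamma>1', \<gamma>2' \<phi>) is annihilated by (\<gamma>2', \<epsilon> \<gamma>1' n).
  The obstacle is the scale s. A priori it varies along the surface, and its derivative ds would
  then add ds(a) h(b,c) and its cyclic companions to the cubic form. For a nonzero one-form on the
  surface these terms are not invariant under a third of a turn. The volume conditions of the
  surface and of the hypersurface together remove them.\<close>

lemma frechet_derivative_eqI:
  "(f has_derivative f') (at u) \<Longrightarrow> frechet_derivative f (at u) = f'"
  by (metis frechet_derivative_at)

lemma C_on_cong:
  assumes "open U" "\<And>u. u \<in> U \<Longrightarrow> f u = g u"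
  shows "C_on k U f \<longleftrightarrow> C_on k U g"
  using assms(2)
proof (induction k arbitrary: f g)
  case 0
  then show ?case by (simp cong: continuous_on_cong)
next
  case (Suc k)
  have d: "(f has_derivative D) (at u) \<longleftrightarrow> (g has_derivative D) (at u)" if "u \<in> U" for u D
    using has_derivative_transform_within_open[OF _ assms(1) that] Suc.prems by metis
  have "frechet_derivative f (at u) = frechet_derivative g (at u)" if "u \<in> U" for u
    using d[OF that] by (simp add: frechet_derivative_def)
  moreover have "f differentiable at u \<longleftrightarrow> g differentiable at u" if "u \<in> U" for u
    using d[OF that] by (simp add: differentiable_def)
  ultimately show ?case
    using Suc.IH[of "\<lambda>u. frechet_derivative f (at u) _" "\<lambda>u. frechet_derivative g (at u) _"] by simp
qed

text \<open>Any explicit family of derivatives may stand in for \<open>frechet_derivative\<close>,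
  so the \<open>has_derivative\<close> rules drive the inductions on k below.\<close>

lemma C_on_SucI:
  assumes "open U" "\<And>u. u \<in> U \<Longrightarrow> (f has_derivative f' u) (at u)" "\<And>v. C_on k U (\<lambda>u. f' u v)"
  shows "C_on (Suc k) U f"
proof -
  have "C_on k U (\<lambda>u. frechet_derivative f (at u) v)" for v
    using C_on_cong[OF assms(1), of "\<lambda>u. frechet_derivative f (at u) v" "\<lambda>u. f' u v"]
      frechet_derivative_eqI[OF assms(2)] assms(3) by simp
  then show ?thesis
    using assms(2) by (auto simp: differentiable_def)
qed

lemma C_on_SucD: "C_on (Suc k) U f \<Longrightarrow> C_on k U f"
proof (induction k arbitrary: f)
  case 0
  then show ?case
    by (auto simp: continuous_at_imp_continuous_on differentiable_imp_continuous_within)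
next
  case (Suc k)
  then show ?case by (metis C_on.simps(2))
qed

lemma C_on_has_derivative:
  "C_on (Suc k) U f \<Longrightarrow> u \<in> U \<Longrightarrow> (f has_derivative frechet_derivative f (at u)) (at u)"
  by (simp add: frechet_derivative_works[symmetric])

lemma C_on_const: "open U \<Longrightarrow> C_on k U (\<lambda>u. c)"
proof (induction k arbitrary: c)
  case (Suc k)
  then show ?case by (intro C_on_SucI[where f' = "\<lambda>_ _. 0"]) auto
qed auto

lemma C_on_add:
  assumes "open U" "C_on k U f" "C_on k U g"
  shows "C_on k U (\<lambda>u. f u + g u)"
  using assms(2,3)
proof (induction k arbitrary: f g)
  case (Suc k)
  then show ?case
    by (intro C_on_SucI[OF assms(1) has_derivative_add[OF C_on_has_derivative C_on_has_derivative]])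
       auto
qed (auto intro: continuous_on_add)

lemma C_on_bilinear:
  assumes "open U" "bounded_bilinear B" "C_on k U f" "C_on k U g"
  shows "C_on k U (\<lambda>u. B (f u) (g u))"
  using assms(3,4)
proof (induction k arbitrary: f g)
  case 0
  then show ?case by (simp add: bounded_bilinear.continuous_on[OF assms(2)])
next
  case (Suc k)
  show ?case
  proof (rule C_on_SucI[OF assms(1)])
    fix u assume "u \<in> U"
    then show "((\<lambda>u. B (f u) (g u)) has_derivative
        (\<lambda>v. B (f u) (frechet_derivative g (at u) v) + B (frechet_derivative f (at u) v) (g u))) (at u)"
      using C_on_has_derivative[OF Suc.prems(1)] C_on_has_derivative[OF Suc.prems(2)]
      by (intro bounded_bilinear.FDERIV[OF assms(2)])
  next
    fix v
    have "C_on k U f" "C_on k U g"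
      using Suc.prems C_on_SucD by blast+
    then show "C_on k U (\<lambda>u. B (f u) (frechet_derivative g (at u) v) + B (frechet_derivative f (at u) v) (g u))"
      using Suc by (intro C_on_add[OF assms(1)]) auto
  qed
qed

text \<open>For linear L the derivative in direction v is that of f at L u in the fixed direction L
  v, so the induction hypothesis applies to a directional derivative of f. Coordinate functions and
  \<open>pr23\<close> are the inner maps needed later.\<close>

lemma C_on_compose_linear:
  assumes "bounded_linear L" "open U" "open V" "\<And>u. u \<in> V \<Longrightarrow> L u \<in> U" "C_on k U f"
  shows "C_on k V (\<lambda>u. f (L u))"
  using assms(5)
proof (induction k arbitrary: f)
  case 0
  have "continuous_on V L" by (simp add: assms(1) linear_continuous_on)
  then show ?case using 0 assms(4) continuous_on_compose2[of U f V L] by (auto simp: image_subset_iff)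
next
  case (Suc k)
  show ?case
  proof (rule C_on_SucI[OF assms(3)])
    fix u assume u: "u \<in> V"
    have "(f has_derivative frechet_derivative f (at (L u))) (at (L u))"
      using Suc.prems assms(4)[OF u] C_on_has_derivative by blast
    from has_derivative_compose[OF bounded_linear_imp_has_derivative[OF assms(1)] this]
    show "((\<lambda>u. f (L u)) has_derivative (\<lambda>v. frechet_derivative f (at (L u)) (L v))) (at u)" .
  qed (use Suc in auto)
qed

lemma C_on_inverse:
  fixes f :: "'a::real_normed_vector \<Rightarrow> real"
  assumes "open U" "\<And>u. u \<in> U \<Longrightarrow> f u \<noteq> 0" "C_on k U f"
  shows "C_on k U (\<lambda>u. inverse (f u))"
  using assms(3)
proof (induction k)
  case 0
  then show ?case using assms(2) by (auto intro: continuous_on_inverse)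
next
  case (Suc k)
  note bb = C_on_bilinear[OF assms(1) bounded_bilinear_mult]
  show ?case
  proof (rule C_on_SucI[OF assms(1)])
    fix u assume u: "u \<in> U"
    then show "((\<lambda>u. inverse (f u)) has_derivative
        (\<lambda>v. - 1 * (inverse (f u) * (frechet_derivative f (at u) v * inverse (f u))))) (at u)"
      using Deriv.has_derivative_inverse[OF assms(2)[OF u] C_on_has_derivative[OF Suc.prems u]]
      by (simp add: mult.assoc)
  next
    fix v
    have "C_on k U (\<lambda>u. inverse (f u))" using Suc C_on_SucD by blast
    then show "C_on k U (\<lambda>u. - 1 * (inverse (f u) * (frechet_derivative f (at u) v * inverse (f u))))"
      using Suc.prems by (intro bb C_on_const assms(1)) auto
  qed
qed

section \<open>Closure properties of smooth maps\<close>

lemma smooth_on_cong: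
  "open U \<Longrightarrow> (\<And>u. u \<in> U \<Longrightarrow> f u = g u) \<Longrightarrow> smooth_on U f \<longleftrightarrow> smooth_on U g"
  unfolding smooth_on_def using C_on_cong by blast

lemma smooth_on_differentiable: "smooth_on U f \<Longrightarrow> u \<in> U \<Longrightarrow> f differentiable at u"
  unfolding smooth_on_def by (metis C_on.simps(2))

lemma smooth_on_has_derivative:
  "smooth_on U f \<Longrightarrow> u \<in> U \<Longrightarrow> (f has_derivative frechet_derivative f (at u)) (at u)"
  by (simp add: frechet_derivative_works[symmetric] smooth_on_differentiable)

lemma smooth_on_frechet_derivative:
  "smooth_on U f \<Longrightarrow> smooth_on U (\<lambda>u. frechet_derivative f (at u) v)"
  unfolding smooth_on_def by (metis C_on.simps(2))

lemma smooth_on_const: "open U \<Longrightarrow> smooth_on U (\<lambda>u. c)"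
  by (simp add: smooth_on_def C_on_const)

lemma smooth_on_add:
  "open U \<Longrightarrow> smooth_on U f \<Longrightarrow> smooth_on U g \<Longrightarrow> smooth_on U (\<lambda>u. f u + g u)"
  by (simp add: smooth_on_def C_on_add)

lemma smooth_on_bilinear:
  "bounded_bilinear B \<Longrightarrow> open U \<Longrightarrow> smooth_on U f \<Longrightarrow> smooth_on U g \<Longrightarrow> smooth_on U (\<lambda>u. B (f u) (g u))"
  by (simp add: smooth_on_def C_on_bilinear)

lemmas smooth_on_mult = smooth_on_bilinear[OF bounded_bilinear_mult]
lemmas smooth_on_scaleR = smooth_on_bilinear[OF bounded_bilinear_scaleR]
lemmas smooth_on_inner = smooth_on_bilinear[OF bounded_bilinear_inner]

lemma smooth_on_linear_compose:
  assumes "bounded_linear L" "open U" "smooth_on U f"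
  shows "smooth_on U (\<lambda>u. L (f u))"
proof -
  have "C_on k U (\<lambda>u. L (f u))" if "C_on k U f" for k
    using that
  proof (induction k arbitrary: f)
    case 0
    then show ?case using assms(1) bounded_linear.continuous_on by auto
  next
    case (Suc k)
    then show ?case
      by (intro C_on_SucI[OF assms(2) bounded_linear.has_derivative[OF assms(1) C_on_has_derivative]])
         auto
  qed
  with assms(3) show ?thesis by (simp add: smooth_on_def)
qed

lemma smooth_on_compose_linear:
  "bounded_linear L \<Longrightarrow> open U \<Longrightarrow> open V \<Longrightarrow> (\<And>u. u \<in> V \<Longrightarrow> L u \<in> U) \<Longrightarrow> smooth_on U f \<Longrightarrow>
    smooth_on V (\<lambda>u. f (L u))"
  unfolding smooth_on_def using C_on_compose_linear by blast

lemma smooth_on_uminus: "open U \<Longrightarrow> smooth_on U f \<Longrightarrow> smooth_on U (\<lambda>u. - f u)"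
  by (rule smooth_on_linear_compose[OF bounded_linear_minus[OF bounded_linear_ident]])

lemma smooth_on_diff:
  "open U \<Longrightarrow> smooth_on U f \<Longrightarrow> smooth_on U g \<Longrightarrow> smooth_on U (\<lambda>u. f u - g u)"
  using smooth_on_add[of U f "\<lambda>u. - g u"] smooth_on_uminus[of U g] by simp

lemma smooth_on_inverse:
  fixes f :: "'a::real_normed_vector \<Rightarrow> real"
  shows "open U \<Longrightarrow> (\<And>u. u \<in> U \<Longrightarrow> f u \<noteq> 0) \<Longrightarrow> smooth_on U f \<Longrightarrow> smooth_on U (\<lambda>u. inverse (f u))"
  unfolding smooth_on_def using C_on_inverse by blast

lemma smooth_on_divide:
  fixes f :: "'a::real_normed_vector \<Rightarrow> real"
  shows "open U \<Longrightarrow> (\<And>u. u \<in> U \<Longrightarrow> g u \<noteq> 0) \<Longrightarrow> smooth_on U f \<Longrightarrow> smooth_on U g \<Longrightarrow>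
    smooth_on U (\<lambda>u. f u / g u)"
  unfolding divide_inverse using smooth_on_mult smooth_on_inverse by blast

lemma smooth_on_sum:
  "open U \<Longrightarrow> (\<And>i. i \<in> S \<Longrightarrow> smooth_on U (f i)) \<Longrightarrow> smooth_on U (\<lambda>u. \<Sum>i\<in>S. f i u)"
  by (induction S rule: infinite_finite_induct) (auto intro: smooth_on_const smooth_on_add)

lemma smooth_on_prod:
  fixes f :: "'i \<Rightarrow> 'a::real_normed_vector \<Rightarrow> real"
  shows "open U \<Longrightarrow> (\<And>i. i \<in> S \<Longrightarrow> smooth_on U (f i)) \<Longrightarrow> smooth_on U (\<lambda>u. \<Prod>i\<in>S. f i u)"
  by (induction S rule: infinite_finite_induct) (auto intro: smooth_on_const smooth_on_mult)

lemma smooth_on_component: "open U \<Longrightarrow> smooth_on U f \<Longrightarrow> smooth_on U (\<lambda>u. f u $ i)"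
  by (rule smooth_on_linear_compose[OF bounded_linear_vec_nth])

lemma smooth_on_vec:
  fixes f :: "'a::real_normed_vector \<Rightarrow> real^'n"
  assumes "open U" "\<And>i. smooth_on U (\<lambda>u. f u $ i)"
  shows "smooth_on U f"
proof -
  have "smooth_on U (\<lambda>u. \<Sum>i\<in>UNIV. f u $ i *\<^sub>R axis i (1::real))"
    by (intro smooth_on_sum smooth_on_scaleR smooth_on_const assms)
  moreover have "(\<lambda>u. \<Sum>i\<in>UNIV. f u $ i *\<^sub>R axis i (1::real)) = f"
    using basis_expansion[of "f _"] unfolding scalar_mult_eq_scaleR by (intro ext)
  ultimately show ?thesis by simp
qed

lemma smooth_on_det:
  fixes M :: "'a::real_normed_vector \<Rightarrow> real^'n^'n"
  assumes "open U" "\<And>i j. smooth_on U (\<lambda>u. M u $ i $ j)"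
  shows "smooth_on U (\<lambda>u. det (M u))"
  unfolding det_def by (intro smooth_on_sum smooth_on_mult smooth_on_prod smooth_on_const assms)

lemma linear_vec_expansion:
  fixes L :: "real^'n \<Rightarrow> 'b::real_vector"
  assumes "linear L"
  shows "L x = (\<Sum>i\<in>UNIV. x $ i *\<^sub>R L (axis i (1::real)))"
proof -
  have "L x = L (\<Sum>i\<in>UNIV. x $ i *\<^sub>R axis i (1::real))"
    using basis_expansion[of x] unfolding scalar_mult_eq_scaleR by simp
  then show ?thesis by (simp add: linear_sum[OF assms] linear_cmul[OF assms])
qed

text \<open>\<open>C_on\<close> speaks of derivatives in constant directions only; expanding the
  field X in the standard basis reduces a varying direction to these.\<close>

lemma smooth_on_dir_deriv:
  assumes "open U" "smooth_on U X" "smooth_on U Y"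
  shows "smooth_on U (dir_deriv X Y)"
proof -
  have "smooth_on U (\<lambda>u. \<Sum>i\<in>UNIV. X u $ i *\<^sub>R frechet_derivative Y (at u) (axis i (1::real)))"
    using assms
    by (intro smooth_on_sum smooth_on_scaleR smooth_on_component smooth_on_frechet_derivative)
  moreover have "dir_deriv X Y u = (\<Sum>i\<in>UNIV. X u $ i *\<^sub>R frechet_derivative Y (at u) (axis i (1::real)))"
    if "u \<in> U" for u
    unfolding dir_deriv_def
    using linear_frechet_derivative[OF smooth_on_differentiable[OF assms(3) that]]
    by (rule linear_vec_expansion)
  ultimately show ?thesis
    using smooth_on_cong[OF assms(1)] by (metis (no_types, lifting))
qed

text \<open>The mean value theorem, first in direction \<open>a\<close> and then in direction \<open>b\<close>; the left-hand side
  is symmetric in \<open>a\<close> and \<open>b\<close>, which is what makes second derivatives commute.\<close>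

lemma second_difference_mvt:
  fixes f :: "'a::real_normed_vector \<Rightarrow> real"
  assumes f: "C_on 2 U f" and s: "0 < s"
    and U: "\<And>p q. 0 \<le> p \<Longrightarrow> p \<le> s \<Longrightarrow> 0 \<le> q \<Longrightarrow> q \<le> s \<Longrightarrow> u + p *\<^sub>R a + q *\<^sub>R b \<in> U"
  obtains p q where "0 \<le> p" "p \<le> s" "0 \<le> q" "q \<le> s"
    "f (u + s *\<^sub>R a + s *\<^sub>R b) - f (u + s *\<^sub>R a) - f (u + s *\<^sub>R b) + f u =
     s * (s * frechet_derivative (\<lambda>v. frechet_derivative f (at v) a) (at (u + p *\<^sub>R a + q *\<^sub>R b)) b)"
proof -
  let ?D = "\<lambda>v. frechet_derivative f (at v)"
  have f1: "(f has_derivative ?D v) (at v)" if "v \<in> U" for v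
    using f that by (intro C_on_has_derivative[of "Suc 0"]) (auto simp: numeral_2_eq_2)
  have f2: "((\<lambda>v. ?D v a) has_derivative frechet_derivative (\<lambda>v. ?D v a) (at v)) (at v)"
    if "v \<in> U" for v
    using f that by (intro C_on_has_derivative[of 0 U]) (simp_all add: numeral_2_eq_2)
  have d1: "((\<lambda>p. f (u + p *\<^sub>R a + q *\<^sub>R b)) has_derivative (\<lambda>r. ?D (u + p *\<^sub>R a + q *\<^sub>R b) (r *\<^sub>R a))) (at p)"
    if "0 \<le> p" "p \<le> s" "0 \<le> q" "q \<le> s" for p q
    using f1[OF U[OF that]]
    by (intro has_derivative_compose[where f = "\<lambda>p. u + p *\<^sub>R a + q *\<^sub>R b" and g = f])
       (auto intro!: derivative_eq_intros)
  have lin: "linear (?D v)" if "v \<in> U" for v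
    using f1[OF that] has_derivative_linear by blast
  have "\<exists>p. 0 < p \<and> p < s \<and>
      (f (u + s *\<^sub>R a + s *\<^sub>R b) - f (u + s *\<^sub>R a + 0 *\<^sub>R b)) - (f (u + 0 *\<^sub>R a + s *\<^sub>R b) - f (u + 0 *\<^sub>R a + 0 *\<^sub>R b))
      = (s - 0) * (?D (u + p *\<^sub>R a + s *\<^sub>R b) a - ?D (u + p *\<^sub>R a + 0 *\<^sub>R b) a)"
  proof (rule MVT2[OF s])
    fix p :: real assume p: "0 \<le> p" "p \<le> s"
    have "((\<lambda>p. f (u + p *\<^sub>R a + s *\<^sub>R b) - f (u + p *\<^sub>R a + 0 *\<^sub>R b)) has_derivative
       (\<lambda>r. ?D (u + p *\<^sub>R a + s *\<^sub>R b) (r *\<^sub>R a) - ?D (u + p *\<^sub>R a + 0 *\<^sub>R b) (r *\<^sub>R a))) (at p)"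
      using p s by (intro has_derivative_diff d1) auto
    moreover have "(\<lambda>r. ?D (u + p *\<^sub>R a + s *\<^sub>R b) (r *\<^sub>R a) - ?D (u + p *\<^sub>R a + 0 *\<^sub>R b) (r *\<^sub>R a)) =
       (*) (?D (u + p *\<^sub>R a + s *\<^sub>R b) a - ?D (u + p *\<^sub>R a + 0 *\<^sub>R b) a)"
      using lin[OF U[of p s]] lin[OF U[of p 0]] p s
      by (auto simp: fun_eq_iff linear_cmul algebra_simps simp del: scaleR_zero_left)
    ultimately show "((\<lambda>p. f (u + p *\<^sub>R a + s *\<^sub>R b) - f (u + p *\<^sub>R a + 0 *\<^sub>R b)) has_real_derivative
       (?D (u + p *\<^sub>R a + s *\<^sub>R b) a - ?D (u + p *\<^sub>R a + 0 *\<^sub>R b) a)) (at p)"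
      by (simp add: has_field_derivative_def)
  qed
  then obtain p where p: "0 < p" "p < s" and e1:
      "f (u + s *\<^sub>R a + s *\<^sub>R b) - f (u + s *\<^sub>R a) - f (u + s *\<^sub>R b) + f u
      = s * (?D (u + p *\<^sub>R a + s *\<^sub>R b) a - ?D (u + p *\<^sub>R a + 0 *\<^sub>R b) a)"
    by (auto simp: algebra_simps)
  have "\<exists>q. 0 < q \<and> q < s \<and> ?D (u + p *\<^sub>R a + s *\<^sub>R b) a - ?D (u + p *\<^sub>R a + 0 *\<^sub>R b) a =
     (s - 0) * frechet_derivative (\<lambda>v. ?D v a) (at (u + p *\<^sub>R a + q *\<^sub>R b)) b"
  proof (rule MVT2[OF s])
    fix q assume q: "0 \<le> q" "q \<le> s"
    have i: "u + p *\<^sub>R a + q *\<^sub>R b \<in> U" using p q U by auto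
    have "((\<lambda>q. ?D (u + p *\<^sub>R a + q *\<^sub>R b) a) has_derivative
        (\<lambda>r. frechet_derivative (\<lambda>v. ?D v a) (at (u + p *\<^sub>R a + q *\<^sub>R b)) (r *\<^sub>R b))) (at q)"
      using f2[OF i]
      by (intro has_derivative_compose[where f = "\<lambda>q. u + p *\<^sub>R a + q *\<^sub>R b" and g = "\<lambda>v. ?D v a"])
         (auto intro!: derivative_eq_intros)
    moreover have "linear (frechet_derivative (\<lambda>v. ?D v a) (at (u + p *\<^sub>R a + q *\<^sub>R b)))"
      using f2[OF i] has_derivative_linear by blast
    ultimately show "((\<lambda>q. ?D (u + p *\<^sub>R a + q *\<^sub>R b) a) has_real_derivative
        frechet_derivative (\<lambda>v. ?D v a) (at (u + p *\<^sub>R a + q *\<^sub>R b)) b) (at q)"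
      by (simp add: has_field_derivative_def linear_cmul mult.commute[of _ "frechet_derivative _ _ _"])
  qed
  then obtain q where "0 < q" "q < s" "?D (u + p *\<^sub>R a + s *\<^sub>R b) a - ?D (u + p *\<^sub>R a + 0 *\<^sub>R b) a =
     s * frechet_derivative (\<lambda>v. ?D v a) (at (u + p *\<^sub>R a + q *\<^sub>R b)) b"
    by auto
  with p e1 show thesis by (intro that[of p q]) auto
qed

text \<open>One and the same second difference equals s^2 times either mixed derivative, each at
  some point of a small parallelogram. Cancelling s^2 and using continuity of both mixed derivatives
  at u makes their distance at most any e > 0.\<close>

lemma frechet_derivative_commute_real:
  fixes f :: "'a::real_normed_vector \<Rightarrow> real"
  assumes U: "open U" "u \<in> U" and f: "C_on 2 U f"
  shows "frechet_derivative (\<lambda>v. frechet_derivative f (at v) a) (at u) b =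
         frechet_derivative (\<lambda>v. frechet_derivative f (at v) b) (at u) a"
proof -
  define G where "G a b u = frechet_derivative (\<lambda>v. frechet_derivative f (at v) a) (at u) b" for a b u
  have cont: "isCont (G a b) u" for a b
    using f U by (auto simp: G_def[abs_def] numeral_2_eq_2 continuous_on_eq_continuous_at)
  have "dist (G a b u) (G b a u) \<le> e" if e: "e > 0" for e
  proof -
    obtain d0 where d0: "d0 > 0" "ball u d0 \<subseteq> U" using U open_contains_ball by blast
    obtain d1 where d1: "d1 > 0" "\<And>v. dist v u < d1 \<Longrightarrow> dist (G a b v) (G a b u) < e / 2"
      using cont[of a b, unfolded continuous_at_eps_delta, rule_format, of "e / 2"] e by auto
    obtain d2 where d2: "d2 > 0" "\<And>v. dist v u < d2 \<Longrightarrow> dist (G b a v) (G b a u) < e / 2"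
      using cont[of b a, unfolded continuous_at_eps_delta, rule_format, of "e / 2"] e by auto
    define d where "d = min d0 (min d1 d2)"
    \<comment> \<open>The summand 1 keeps N positive when a and b vanish; s N = d / 2 keeps the
      parallelogram inside the ball of radius d.\<close>
    define N where "N = norm a + norm b + 1"
    define s where "s = d / (2 * N)"
    have dN: "d > 0" "N > 0" using d0 d1 d2 by (auto simp: d_def N_def add_nonneg_pos)
    then have s: "s > 0" by (simp add: s_def)
    have near: "dist (u + p *\<^sub>R a + q *\<^sub>R b) u < d" if "0 \<le> p" "p \<le> s" "0 \<le> q" "q \<le> s" for p q
    proof -
      have "dist (u + p *\<^sub>R a + q *\<^sub>R b) u \<le> p * norm a + q * norm b"
        using norm_triangle_ineq[of "p *\<^sub>R a" "q *\<^sub>R b"] that by (simp add: dist_norm add.assoc)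
      also have "\<dots> \<le> s * norm a + s * norm b" using that by (intro add_mono mult_right_mono) auto
      also have "\<dots> \<le> s * N" using s by (simp add: N_def algebra_simps)
      also have "\<dots> < d" using dN by (simp add: s_def)
      finally show ?thesis .
    qed
    have inU: "u + p *\<^sub>R a + q *\<^sub>R b \<in> U" "u + q *\<^sub>R b + p *\<^sub>R a \<in> U"
      if "0 \<le> p" "p \<le> s" "0 \<le> q" "q \<le> s" for p q
      using near[OF that] d0(2) by (auto simp: d_def dist_commute subset_iff algebra_simps)
    obtain p q where pq: "0 \<le> p" "p \<le> s" "0 \<le> q" "q \<le> s" and 1:
      "f (u + s *\<^sub>R a + s *\<^sub>R b) - f (u + s *\<^sub>R a) - f (u + s *\<^sub>R b) + f u = s * (s * G a b (u + p *\<^sub>R a + q *\<^sub>R b))"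
      by (rule second_difference_mvt[OF f s, of u a b, folded G_def]) (use inU that in blast)+
    obtain p' q' where pq': "0 \<le> p'" "p' \<le> s" "0 \<le> q'" "q' \<le> s" and 2:
      "f (u + s *\<^sub>R b + s *\<^sub>R a) - f (u + s *\<^sub>R b) - f (u + s *\<^sub>R a) + f u = s * (s * G b a (u + q' *\<^sub>R b + p' *\<^sub>R a))"
      by (rule second_difference_mvt[OF f s, of u b a, folded G_def]) (use inU that in blast)+
    have "s * (s * G a b (u + p *\<^sub>R a + q *\<^sub>R b)) = s * (s * G b a (u + q' *\<^sub>R b + p' *\<^sub>R a))"
      using 1 2 by (simp add: algebra_simps)
    then have eq: "G a b (u + p *\<^sub>R a + q *\<^sub>R b) = G b a (u + p' *\<^sub>R a + q' *\<^sub>R b)"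
      using s by (simp add: algebra_simps)
    have "dist (G a b (u + p *\<^sub>R a + q *\<^sub>R b)) (G a b u) < e / 2"
      using near[OF pq] by (intro d1) (simp add: d_def)
    moreover have "dist (G b a (u + p' *\<^sub>R a + q' *\<^sub>R b)) (G b a u) < e / 2"
      using near[OF pq'] by (intro d2) (simp add: d_def)
    ultimately show ?thesis
      using dist_triangle_half_r[of "G a b (u + p *\<^sub>R a + q *\<^sub>R b)" "G a b u" e "G b a u"] eq by simp
  qed
  then have "dist (G a b u) (G b a u) \<le> 0" by (rule field_le_epsilon) simp
  then show ?thesis by (simp add: G_def)
qed

lemma frechet_derivative_bounded_linear:
  "bounded_linear L \<Longrightarrow> f differentiable at u \<Longrightarrow>
    frechet_derivative (\<lambda>v. L (f v)) (at u) a = L (frechet_derivative f (at u) a)"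
  by (metis bounded_linear.has_derivative frechet_derivative_eqI frechet_derivative_works)

lemma frechet_derivative_commute:
  fixes f :: "'a::real_normed_vector \<Rightarrow> real^'m"
  assumes U: "open U" "u \<in> U" and f: "smooth_on U f"
  shows "frechet_derivative (\<lambda>v. frechet_derivative f (at v) a) (at u) b =
         frechet_derivative (\<lambda>v. frechet_derivative f (at v) b) (at u) a"
proof -
  have "frechet_derivative (\<lambda>v. frechet_derivative f (at v) a) (at u) b $ i =
        frechet_derivative (\<lambda>v. frechet_derivative f (at v) b) (at u) a $ i" for i
  proof -
    have bl: "bounded_linear (\<lambda>x::real^'m. x $ i)" by (rule bounded_linear_vec_nth)
    have "frechet_derivative (\<lambda>v. frechet_derivative f (at v) a) (at u) b $ i =
          frechet_derivative (\<lambda>v. frechet_derivative (\<lambda>v. f v $ i) (at v) a) (at u) b" for a b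
    proof -
      have "frechet_derivative (\<lambda>v. frechet_derivative f (at v) a $ i) (at u) =
          frechet_derivative (\<lambda>v. frechet_derivative (\<lambda>v. f v $ i) (at v) a) (at u)"
        using frechet_derivative_bounded_linear[OF bl smooth_on_differentiable[OF f]]
          smooth_on_differentiable[OF smooth_on_component[OF U(1) smooth_on_frechet_derivative[OF f]] U(2)]
        by (intro frechet_derivative_transform_within_open[OF _ U]) auto
      then show ?thesis
        using frechet_derivative_bounded_linear[OF bl
            smooth_on_differentiable[OF smooth_on_frechet_derivative[OF f] U(2)]] by metis
    qed
    moreover have "C_on 2 U (\<lambda>v. f v $ i)"
      using smooth_on_component[OF U(1) f] smooth_on_def by blast
    ultimately show ?thesis using frechet_derivative_commute_real[OF U] by metis
  qed
  then show ?thesis by (simp add: vec_eq_iff)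
qed

section \<open>The Levi-Civita connection\<close>

text \<open>A product rule for B v (Y v) when B is known to be differentiable only with its vector
  argument held fixed: in the standard basis the pairing is a finite sum of products of real
  functions. Applying it once per slot differentiates g(Y, Z).\<close>

lemma frechet_derivative_linear_field:
  fixes B :: "'a::real_normed_vector \<Rightarrow> real^'n \<Rightarrow> real"
  assumes U: "open U" "u \<in> U" and lin: "\<And>v. v \<in> U \<Longrightarrow> linear (B v)"
    and B: "\<And>a. (\<lambda>v. B v a) differentiable at u" and Y: "Y differentiable at u"
  shows "((\<lambda>v. B v (Y v)) has_derivative
    (\<lambda>c. frechet_derivative (\<lambda>v. B v (Y u)) (at u) c + B u (frechet_derivative Y (at u) c))) (at u)"
proof -
  let ?e = "\<lambda>i. axis i 1 :: real^'n"
  have expand: "B v x = (\<Sum>i\<in>UNIV. x $ i * B v (?e i))" if "v \<in> U" for v x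
    using linear_vec_expansion[OF lin[OF that], of x] by simp
  have dB: "((\<lambda>v. B v a) has_derivative frechet_derivative (\<lambda>v. B v a) (at u)) (at u)" for a
    using B frechet_derivative_works by blast
  have dY: "((\<lambda>v. Y v $ i) has_derivative (\<lambda>c. frechet_derivative Y (at u) c $ i)) (at u)" for i
    using Y frechet_derivative_works bounded_linear.has_derivative[OF bounded_linear_vec_nth] by blast
  have "((\<lambda>v. \<Sum>i\<in>UNIV. Y v $ i * B v (?e i)) has_derivative
      (\<lambda>c. \<Sum>i\<in>UNIV. Y u $ i * frechet_derivative (\<lambda>v. B v (?e i)) (at u) c +
        frechet_derivative Y (at u) c $ i * B u (?e i))) (at u)"
    by (intro has_derivative_sum has_derivative_mult dB dY)
  then have 1: "((\<lambda>v. B v (Y v)) has_derivative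
      (\<lambda>c. \<Sum>i\<in>UNIV. Y u $ i * frechet_derivative (\<lambda>v. B v (?e i)) (at u) c +
        frechet_derivative Y (at u) c $ i * B u (?e i))) (at u)"
    using expand by (elim has_derivative_transform_within_open[OF _ U]) auto
  have "((\<lambda>v. \<Sum>i\<in>UNIV. Y u $ i * B v (?e i)) has_derivative
      (\<lambda>c. \<Sum>i\<in>UNIV. Y u $ i * frechet_derivative (\<lambda>v. B v (?e i)) (at u) c)) (at u)"
    by (intro has_derivative_sum has_derivative_mult_right dB)
  then have "((\<lambda>v. B v (Y u)) has_derivative
      (\<lambda>c. \<Sum>i\<in>UNIV. Y u $ i * frechet_derivative (\<lambda>v. B v (?e i)) (at u) c)) (at u)"
    using expand by (elim has_derivative_transform_within_open[OF _ U]) auto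
  then have 2: "frechet_derivative (\<lambda>v. B v (Y u)) (at u) =
      (\<lambda>c. \<Sum>i\<in>UNIV. Y u $ i * frechet_derivative (\<lambda>v. B v (?e i)) (at u) c)"
    by (rule frechet_derivative_eqI)
  have "(\<Sum>i\<in>UNIV. Y u $ i * frechet_derivative (\<lambda>v. B v (?e i)) (at u) c +
        frechet_derivative Y (at u) c $ i * B u (?e i)) =
      frechet_derivative (\<lambda>v. B v (Y u)) (at u) c + B u (frechet_derivative Y (at u) c)" for c
    unfolding 2 by (simp add: sum.distrib expand[OF U(2), of "frechet_derivative Y (at u) c"])
  with 1 show ?thesis by simp
qed

locale smooth_metric =
  fixes U :: "(real^'n) set" and g :: "real^'n \<Rightarrow> real^'n \<Rightarrow> real^'n \<Rightarrow> real"
  assumes open_dom: "open U"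
    and smooth: "\<And>a b. smooth_on U (\<lambda>u. g u a b)"
    and linear_left: "\<And>u b. u \<in> U \<Longrightarrow> linear (\<lambda>a. g u a b)"
    and sym: "\<And>u a b. u \<in> U \<Longrightarrow> g u a b = g u b a"
    and nondeg: "\<And>u. u \<in> U \<Longrightarrow> nondegenerate_form (g u)"
begin

lemma linear_right: "u \<in> U \<Longrightarrow> linear (g u a)"
  using linear_left[of u a] sym[of u] by (simp add: linear_iff)

lemma eqI:
  assumes "u \<in> U" "\<And>c. g u a c = g u b c"
  shows "a = b"
proof -
  have "g u (a - b) c = 0" for c
    using assms linear_diff[OF linear_left[OF assms(1)]] by simp
  then show ?thesis
    using nondeg[OF assms(1)] unfolding nondegenerate_form_def by (metis eq_iff_diff_eq_0)
qed

definition dg :: "real^'n \<Rightarrow> real^'n \<Rightarrow> real^'n \<Rightarrow> real^'n \<Rightarrow> real" where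
  "dg u c a b = frechet_derivative (\<lambda>v. g v a b) (at u) c"

lemma has_derivative_g: "u \<in> U \<Longrightarrow> ((\<lambda>v. g v a b) has_derivative (\<lambda>c. dg u c a b)) (at u)"
  unfolding dg_def using smooth smooth_on_has_derivative by fastforce

lemma dg_linear1: "u \<in> U \<Longrightarrow> linear (\<lambda>c. dg u c a b)"
  using has_derivative_g has_derivative_linear by blast

lemma dg_sym: 
  assumes "u \<in> U" shows "dg u c a b = dg u c b a"
proof -
  have "((\<lambda>v. g v b a) has_derivative (\<lambda>c. dg u c a b)) (at u)"
    by (rule has_derivative_transform_within_open[OF has_derivative_g[OF assms] open_dom assms]) (rule sym)
  from has_derivative_unique[OF has_derivative_g[OF assms] this] show ?thesis by (simp add: fun_eq_iff)
qed

lemma dg_linear2: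
  assumes "u \<in> U" shows "linear (\<lambda>a. dg u c a b)"
proof (rule linearI)
  fix a a'
  have "((\<lambda>v. g v (a + a') b) has_derivative (\<lambda>c. dg u c a b + dg u c a' b)) (at u)"
    by (rule has_derivative_transform_within_open[OF has_derivative_add[OF
          has_derivative_g[OF assms, of a b] has_derivative_g[OF assms, of a' b]] open_dom assms])
       (simp add: linear_add[OF linear_left])
  from has_derivative_unique[OF has_derivative_g[OF assms] this]
  show "dg u c (a + a') b = dg u c a b + dg u c a' b" by (simp add: fun_eq_iff)
next
  fix r a
  have "((\<lambda>v. g v (r *\<^sub>R a) b) has_derivative (\<lambda>c. r *\<^sub>R dg u c a b)) (at u)"
    by (rule has_derivative_transform_within_open[OF has_derivative_scaleR_right[OF
          has_derivative_g[OF assms, of a b]] open_dom assms])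
       (simp add: linear_cmul[OF linear_left])
  from has_derivative_unique[OF has_derivative_g[OF assms] this]
  show "dg u c (r *\<^sub>R a) b = r *\<^sub>R dg u c a b" by (simp add: fun_eq_iff)
qed

lemma dg_linear3: "u \<in> U \<Longrightarrow> linear (dg u c a)"
  using dg_linear2[of u c a] dg_sym[of u] by (simp add: linear_iff)

text \<open>The right-hand side of the Koszul formula on constant fields, where all Lie brackets
  vanish: the Christoffel symbols of the first kind.\<close>

definition koszul :: "real^'n \<Rightarrow> real^'n \<Rightarrow> real^'n \<Rightarrow> real^'n \<Rightarrow> real" where
  "koszul u a b c = (dg u a b c + dg u b a c - dg u c a b) / 2"

definition gram :: "real^'n \<Rightarrow> real^'n^'n" where
  "gram u = (\<chi> i j. g u (axis i 1) (axis j 1))"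

text \<open>Raises the index of \<open>koszul\<close> by Cramer's rule; as a quotient of
  determinants the result is visibly smooth in u.\<close>

definition christoffel :: "real^'n \<Rightarrow> real^'n \<Rightarrow> real^'n \<Rightarrow> real^'n" where
  "christoffel u a b = (\<chi> k. det (\<chi> i j. if j = k then koszul u a b (axis i 1) else gram u $ i $ j) / det (gram u))"

lemma gram_mult: "u \<in> U \<Longrightarrow> (gram u *v w) $ i = g u w (axis i 1)"
  using linear_vec_expansion[OF linear_right[of u "axis i 1"], of w] sym[of u w]
  by (simp add: gram_def matrix_vector_mult_def mult.commute)

lemma det_gram: 
  assumes "u \<in> U" shows "det (gram u) \<noteq> 0"
proof
  assume "det (gram u) = 0"
  then obtain w where w: "w \<noteq> 0" "gram u *v w = 0"
    using invertible_det_nz[of "gram u"] matrix_left_invertible_ker[of "gram u"]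
    by (auto simp: invertible_left_inverse)
  have "g u w b = 0" for b
  proof -
    have "g u w (axis i 1) = 0" for i using gram_mult[OF assms, of w i] w by simp
    then show ?thesis using linear_vec_expansion[OF linear_right[OF assms, of w], of b] by simp
  qed
  then show False using w nondeg[OF assms] by (simp add: nondegenerate_form_def)
qed

lemma g_christoffel: 
  assumes "u \<in> U" shows "g u (christoffel u a b) c = koszul u a b c"
proof -
  have "gram u *v christoffel u a b = (\<chi> i. koszul u a b (axis i 1))"
    unfolding cramer[OF det_gram[OF assms]] christoffel_def by (simp cong: if_cong)
  then have 1: "g u (christoffel u a b) (axis i 1) = koszul u a b (axis i 1)" for i
    using gram_mult[OF assms, of "christoffel u a b" i] by simp
  have "linear (koszul u a b)"
    using dg_linear1[OF assms] dg_linear3[OF assms]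
    by (simp add: koszul_def linear_iff add_divide_distrib diff_divide_distrib algebra_simps)
  then show ?thesis
    using linear_vec_expansion[of "koszul u a b" c]
      linear_vec_expansion[OF linear_right[OF assms, of "christoffel u a b"], of c] 1 by simp
qed

lemma christoffel_sym: "u \<in> U \<Longrightarrow> christoffel u a b = christoffel u b a"
  by (rule eqI) (auto simp: g_christoffel koszul_def dg_sym)

lemma christoffel_linear: 
  assumes "u \<in> U" shows "linear (\<lambda>a. christoffel u a b)"
proof (rule linearI)
  have l: "linear (\<lambda>a. koszul u a b c)" for c
    using dg_linear1[OF assms] dg_linear2[OF assms]
    by (simp add: koszul_def linear_iff add_divide_distrib diff_divide_distrib algebra_simps)
  show "christoffel u (a + a') b = christoffel u a b + christoffel u a' b" for a a'
    by (rule eqI[OF assms]) (simp add: g_christoffel[OF assms] linear_add[OF linear_left[OF assms]] linear_add[OF l])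
  show "christoffel u (r *\<^sub>R a) b = r *\<^sub>R christoffel u a b" for r a
    by (rule eqI[OF assms]) (simp add: g_christoffel[OF assms] linear_cmul[OF linear_left[OF assms]] linear_cmul[OF l])
qed

lemma christoffel_linear_right: "u \<in> U \<Longrightarrow> linear (christoffel u a)"
  using christoffel_linear[of u a] christoffel_sym[of u] by (simp add: linear_iff)

lemma smooth_christoffel: "smooth_on U (\<lambda>u. christoffel u a b)"
proof (rule smooth_on_vec[OF open_dom])
  have k: "smooth_on U (\<lambda>u. koszul u a b c)" for c
    unfolding koszul_def dg_def
    by (intro smooth_on_divide smooth_on_const smooth_on_diff smooth_on_add smooth_on_frechet_derivative smooth open_dom) auto
  have entry: "smooth_on U (\<lambda>u. (\<chi> i j. if j = k then koszul u a b (axis i 1) else gram u $ i $ j) $ i $ j)" for k i j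
    using k smooth by (cases "j = k") (auto simp: gram_def)
  show "smooth_on U (\<lambda>u. christoffel u a b $ i)" for i
    unfolding christoffel_def vec_lambda_beta
    by (intro smooth_on_divide smooth_on_det open_dom det_gram entry) (auto simp: gram_def smooth)
qed

lemma smooth_christoffel_fields:
  assumes "smooth_on U X" "smooth_on U Y"
  shows "smooth_on U (\<lambda>u. christoffel u (X u) (Y u))"
proof -
  have "smooth_on U (\<lambda>u. \<Sum>i\<in>UNIV. X u $ i *\<^sub>R (\<Sum>j\<in>UNIV. Y u $ j *\<^sub>R christoffel u (axis i 1) (axis j 1)))"
    by (intro smooth_on_sum smooth_on_scaleR smooth_on_component smooth_christoffel assms open_dom)
  moreover have "christoffel u (X u) (Y u) =
      (\<Sum>i\<in>UNIV. X u $ i *\<^sub>R (\<Sum>j\<in>UNIV. Y u $ j *\<^sub>R christoffel u (axis i 1) (axis j 1)))" if "u \<in> U" for u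
    by (subst linear_vec_expansion[OF christoffel_linear[OF that]],
        subst linear_vec_expansion[OF christoffel_linear_right[OF that]]) (rule refl)
  ultimately show ?thesis
    using smooth_on_cong[OF open_dom, of "\<lambda>u. christoffel u (X u) (Y u)"] by simp
qed

lemma dir_deriv_g:
  assumes "u \<in> U" "Y differentiable at u" "Z differentiable at u"
  shows "dir_deriv X (\<lambda>v. g v (Y v) (Z v)) u =
    dg u (X u) (Y u) (Z u) + g u (dir_deriv X Y u) (Z u) + g u (Y u) (dir_deriv X Z u)"
proof -
  have 1: "((\<lambda>v. g v (Y v) z) has_derivative (\<lambda>c. dg u c (Y u) z + g u (frechet_derivative Y (at u) c) z)) (at u)" for z
    unfolding dg_def
    by (rule frechet_derivative_linear_field[OF open_dom assms(1) linear_left _ assms(2)])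
       (auto intro!: smooth_on_differentiable[OF smooth assms(1)])
  have "((\<lambda>v. g v (Y v) (Z v)) has_derivative (\<lambda>c. frechet_derivative (\<lambda>v. g v (Y v) (Z u)) (at u) c +
      g u (Y u) (frechet_derivative Z (at u) c))) (at u)"
    by (rule frechet_derivative_linear_field[OF open_dom assms(1) linear_right _ assms(3)])
       (use 1 in \<open>auto simp: differentiable_def\<close>)
  from frechet_derivative_eqI[OF this] show ?thesis
    by (simp add: dir_deriv_def frechet_derivative_eqI[OF 1])
qed

text \<open>\<open>levi_civita\<close> is a Hilbert choice, so a witness is needed before anything
  can be said about it. The witness is the flat derivative corrected by the Christoffel
  symbols.\<close>

lemma levi_civita_exists: "\<exists>N. is_levi_civita U g N"
proof
  define N where "N X Y u = dir_deriv X Y u + christoffel u (X u) (Y u)"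
    for X Y :: "real^'n \<Rightarrow> real^'n" and u
  have "connection_on U N"
    unfolding connection_on_def
  proof (intro allI impI conjI ballI; elim conjE)
    fix X Y Z :: "real^'n \<Rightarrow> real^'n" and f :: "real^'n \<Rightarrow> real"
    assume X: "smooth_on U X" and Y: "smooth_on U Y" and Z: "smooth_on U Z" and f: "smooth_on U f"
    show "smooth_on U (N X Y)"
      unfolding N_def by (intro smooth_on_add open_dom smooth_christoffel_fields smooth_on_dir_deriv X Y)
    fix u assume u: "u \<in> U"
    note d = smooth_on_has_derivative[OF Y u] smooth_on_has_derivative[OF Z u] smooth_on_has_derivative[OF f u]
    have lD: "linear (frechet_derivative Z (at u))" "linear (frechet_derivative Y (at u))"
      using d has_derivative_linear by blast+
    show "N (\<lambda>v. X v + Y v) Z u = N X Z u + N Y Z u"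
      by (simp add: N_def dir_deriv_def linear_add[OF lD(1)] linear_add[OF christoffel_linear[OF u]])
    show "N (\<lambda>v. f v *\<^sub>R X v) Z u = f u *\<^sub>R N X Z u"
      by (simp add: N_def dir_deriv_def linear_cmul[OF lD(1)] linear_cmul[OF christoffel_linear[OF u]] scaleR_add_right)
    show "N X (\<lambda>v. Y v + Z v) u = N X Y u + N X Z u"
      by (simp add: N_def dir_deriv_def frechet_derivative_eqI[OF has_derivative_add[OF d(1,2)]]
          linear_add[OF christoffel_linear_right[OF u]])
    show "N X (\<lambda>v. f v *\<^sub>R Y v) u = f u *\<^sub>R N X Y u + dir_deriv X f u *\<^sub>R Y u"
      by (simp add: N_def dir_deriv_def frechet_derivative_eqI[OF has_derivative_scaleR[OF d(3,1)]]
          linear_cmul[OF christoffel_linear_right[OF u]] scaleR_add_right)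
  qed
  moreover have "N X Y u - N Y X u = lie_bracket X Y u" if "u \<in> U" for X Y u
    using christoffel_sym[OF that] by (simp add: N_def lie_bracket_def)
  moreover have "dir_deriv X (\<lambda>v. g v (Y v) (Z v)) u = g u (N X Y u) (Z u) + g u (Y u) (N X Z u)"
    if "smooth_on U Y" "smooth_on U Z" "u \<in> U" for X Y Z u
  proof -
    have "g u (Y u) (christoffel u (X u) (Z u)) = koszul u (X u) (Z u) (Y u)"
      using that(3) sym g_christoffel by metis
    then show ?thesis
      using that unfolding N_def
      by (simp add: dir_deriv_g smooth_on_differentiable linear_add[OF linear_left[OF that(3)]]
          linear_add[OF linear_right[OF that(3)]] g_christoffel)
         (simp add: koszul_def dg_sym field_simps)
  qed
  ultimately show "is_levi_civita U g N"
    by (simp add: is_levi_civita_def)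
qed

text \<open>The uniqueness half. Metric compatibility for the three choices of differentiating
  direction, combined by torsion-freeness, leaves twice the wanted term. Whatever the choice
  operator picks, this determines its value on constant fields.\<close>

lemma levi_civita_koszul:
  assumes u: "u \<in> U"
  shows "g u (levi_civita U g (\<lambda>_. a) (\<lambda>_. b) u) c = koszul u a b c"
proof -
  define N where "N = levi_civita U g"
  have N: "is_levi_civita U g N"
    unfolding N_def levi_civita_def by (rule someI_ex[OF levi_civita_exists])
  note const = smooth_on_const[OF open_dom]
  have tf: "N (\<lambda>_. a) (\<lambda>_. b) u = N (\<lambda>_. b) (\<lambda>_. a) u" for a b
  proof -
    have "N (\<lambda>_. a) (\<lambda>_. b) u - N (\<lambda>_. b) (\<lambda>_. a) u = lie_bracket (\<lambda>_. a) (\<lambda>_. b) u"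
      using N const u unfolding is_levi_civita_def by blast
    then show ?thesis by (simp add: lie_bracket_def dir_deriv_def)
  qed
  have "dir_deriv (\<lambda>_. a) (\<lambda>v. g v b c) u = g u (N (\<lambda>_. a) (\<lambda>_. b) u) c + g u b (N (\<lambda>_. a) (\<lambda>_. c) u)" for a b c
    using N const[of a] const[of b] const[of c] u unfolding is_levi_civita_def by blast
  then have "dg u a b c = g u (N (\<lambda>_. a) (\<lambda>_. b) u) c + g u (N (\<lambda>_. a) (\<lambda>_. c) u) b" for a b c
    using sym[OF u] by (simp add: dir_deriv_def dg_def)
  then show ?thesis
    unfolding N_def[symmetric] koszul_def using tf by simp
qed

end

section \<open>The cubic form of a hypersurface with equiaffine conormal\<close>

text \<open>Equality follows by counting dimensions. It turns membership in a tangent space into a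
  single inner product with a conormal.\<close>

lemma range_eq_hyperplane:
  fixes f :: "real^'n \<Rightarrow> real^'m"
  assumes "linear f" "inj f" "CARD('m) = CARD('n) + 1" "\<nu> \<noteq> 0" "\<And>x. \<nu> \<bullet> f x = 0"
  shows "range f = {y. \<nu> \<bullet> y = 0}"
proof (rule subspace_dim_equal)
  show "subspace (range f)" by (simp add: assms(1) linear_subspace_image)
  show "subspace {y. \<nu> \<bullet> y = 0}" by (rule subspace_hyperplane)
  show "range f \<subseteq> {y. \<nu> \<bullet> y = 0}" using assms(5) by auto
  have "dim (range f) = dim (UNIV :: (real^'n) set)"
    using assms(1,2) by (intro dim_image_eq) auto
  then show "dim {y. \<nu> \<bullet> y = 0} \<le> dim (range f)"
    using dim_hyperplane[OF assms(4)] assms(3) by (simp add: dim_UNIV)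
qed

text \<open>Instantiated twice, by the surface and by the warped hypersurface. The last two
  conditions determine \<nu> on U, since the tangent space and \<xi> span the ambient space.\<close>

locale conormal_hypersurface =
  fixes U :: "(real^'n) set" and F \<xi> \<nu> :: "real^'n \<Rightarrow> real^'m"
  assumes immersed: "immersed_hypersurface U F"
    and normal: "affine_normal U F \<xi>"
    and smooth_conormal: "smooth_on U \<nu>"
    and conormal_tangent: "\<And>u a. u \<in> U \<Longrightarrow> \<nu> u \<bullet> frechet_derivative F (at u) a = 0"
    and conormal_normal: "\<And>u. u \<in> U \<Longrightarrow> \<nu> u \<bullet> \<xi> u = 1"
begin

abbreviation "dF u a \<equiv> frechet_derivative F (at u) a"
abbreviation "ddF u a b \<equiv> frechet_derivative (\<lambda>v. dF v b) (at u) a"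
abbreviation "dddF u a b c \<equiv> frechet_derivative (\<lambda>v. ddF v b c) (at u) a"
abbreviation "d\<nu> u a \<equiv> frechet_derivative \<nu> (at u) a"
abbreviation "h \<equiv> affine_metric F \<xi>"
abbreviation "conn u a b \<equiv> induced_connection F \<xi> (\<lambda>_. a) (\<lambda>_. b) u"

lemma open_dom: "open U" and smooth_F: "smooth_on U F" and card: "CARD('m) = CARD('n) + 1"
  using immersed by (auto simp: immersed_hypersurface_def)

lemma smooth_dF: "smooth_on U (\<lambda>u. dF u b)"
  by (intro smooth_on_frechet_derivative smooth_F)

lemma smooth_ddF: "smooth_on U (\<lambda>u. ddF u a b)"
  by (intro smooth_on_frechet_derivative smooth_F)

lemma smooth_\<xi>: "smooth_on U \<xi>"
  using normal by (simp add: affine_normal_def)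

lemma volume:
  fixes X :: "'n \<Rightarrow> real^'n" and e :: "'n \<Rightarrow> 'm"
  assumes "u \<in> U" "inj e"
  shows "\<bar>det (frame_matrix e (\<lambda>i. dF u (X i)) (\<xi> u))\<bar> = sqrt \<bar>det (\<chi> i j. h u (X i) (X j))\<bar>"
  using normal assms by (simp add: affine_normal_def)

lemma linear_dF: "u \<in> U \<Longrightarrow> linear (frechet_derivative F (at u))"
  using linear_frechet_derivative smooth_on_differentiable[OF smooth_F] by blast

lemma range_dF: "u \<in> U \<Longrightarrow> range (frechet_derivative F (at u)) = {y. \<nu> u \<bullet> y = 0}"
  using immersed conormal_tangent[of u] conormal_normal[of u] linear_dF[of u] card
  by (intro range_eq_hyperplane) (auto simp: immersed_hypersurface_def)

lemma dF_inject: "u \<in> U \<Longrightarrow> dF u a = dF u b \<longleftrightarrow> a = b"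
  using immersed by (auto simp: immersed_hypersurface_def inj_eq)

lemma ddF_commute: "u \<in> U \<Longrightarrow> ddF u a b = ddF u b a"
  using frechet_derivative_commute[OF open_dom _ smooth_F] by blast

lemma ddF_linear: "u \<in> U \<Longrightarrow> linear (\<lambda>a. ddF u a b)"
  using linear_frechet_derivative smooth_on_differentiable[OF smooth_dF] by blast

lemma dddF_commute:
  assumes "u \<in> U"
  shows "dddF u a b c = dddF u b a c" "dddF u a b c = dddF u a c b"
proof -
  show "dddF u a b c = dddF u b a c"
    using frechet_derivative_commute[OF open_dom assms smooth_dF] by blast
  have "frechet_derivative (\<lambda>v. ddF v b c) (at u) = frechet_derivative (\<lambda>v. ddF v c b) (at u)"
    by (rule frechet_derivative_transform_within_open[OF _ open_dom assms ddF_commute])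
       (use smooth_on_differentiable[OF smooth_ddF assms] in auto)
  then show "dddF u a b c = dddF u a c b" by simp
qed

text \<open>Pairing the Gauss formula with \<nu> isolates the coefficient of \<xi>, which gives
  uniqueness. Conversely, subtracting that multiple of \<xi> leaves a vector annihilated by \<nu>,
  hence a tangent one; this gives the existence that \<open>THE\<close> requires.\<close>

lemma affine_metric_eq:
  assumes "u \<in> U"
  shows "h u a b = \<nu> u \<bullet> ddF u a b"
proof -
  have eq: "dir_deriv (\<lambda>_. a) (push F (\<lambda>_. b)) u = ddF u a b"
    unfolding dir_deriv_def push_def[abs_def] ..
  have "ddF u a b - (\<nu> u \<bullet> ddF u a b) *\<^sub>R \<xi> u \<in> range (frechet_derivative F (at u))"
    unfolding range_dF[OF assms] by (simp add: inner_diff_right conormal_normal[OF assms])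
  then obtain z where "ddF u a b = dF u z + (\<nu> u \<bullet> ddF u a b) *\<^sub>R \<xi> u"
    by (auto simp: algebra_simps)
  moreover have "c = \<nu> u \<bullet> ddF u a b" if "ddF u a b = dF u z + c *\<^sub>R \<xi> u" for c z
    using that by (simp add: inner_add_right conormal_normal[OF assms] conormal_tangent[OF assms])
  ultimately show ?thesis
    unfolding affine_metric_def eq by blast
qed

lemma dF_conn:
  assumes "u \<in> U"
  shows "dF u (conn u a b) = ddF u a b - h u a b *\<^sub>R \<xi> u"
proof -
  have eq: "dir_deriv (\<lambda>_. a) (push F (\<lambda>_. b)) u = ddF u a b"
    unfolding dir_deriv_def push_def[abs_def] ..
  have "ddF u a b - (\<nu> u \<bullet> ddF u a b) *\<^sub>R \<xi> u \<in> range (frechet_derivative F (at u))"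
    unfolding range_dF[OF assms] by (simp add: inner_diff_right conormal_normal[OF assms])
  then obtain z where z: "ddF u a b = dF u z + h u a b *\<^sub>R \<xi> u"
    by (auto simp: algebra_simps affine_metric_eq[OF assms])
  have "w = z" if w: "ddF u a b = dF u w + c *\<^sub>R \<xi> u" for c w
  proof -
    have "c = h u a b"
      using w by (simp add: affine_metric_eq[OF assms] inner_add_right conormal_normal[OF assms] conormal_tangent[OF assms])
    then show ?thesis using w z dF_inject[OF assms] by simp
  qed
  with z have "conn u a b = z"
    unfolding induced_connection_def eq by blast
  with z show ?thesis by simp
qed

lemma has_derivative_inner_conormal:
  assumes "u \<in> U" "smooth_on U V"
  shows "frechet_derivative (\<lambda>v. \<nu> v \<bullet> V v) (at u) a =
    d\<nu> u a \<bullet> V u + \<nu> u \<bullet> frechet_derivative V (at u) a"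
  by (subst frechet_derivative_eqI[OF has_derivative_inner[OF smooth_on_has_derivative[OF smooth_conormal assms(1)]
        smooth_on_has_derivative[OF assms(2,1)]]]) simp

lemma frechet_derivative_constant_on:
  fixes f :: "real^'n \<Rightarrow> real"
  assumes "u \<in> U" "\<And>v. v \<in> U \<Longrightarrow> f v = c"
  shows "frechet_derivative f (at u) = (\<lambda>_. 0)"
  using has_derivative_transform_within_open[OF has_derivative_const open_dom assms(1), of c f] assms(2)
  by (intro frechet_derivative_eqI) simp

lemma dconormal_dF:
  assumes "u \<in> U"
  shows "d\<nu> u a \<bullet> dF u b = - (\<nu> u \<bullet> ddF u a b)"
proof -
  have "frechet_derivative (\<lambda>v. \<nu> v \<bullet> dF v b) (at u) = (\<lambda>_. 0)"
    by (rule frechet_derivative_constant_on[OF assms]) (rule conormal_tangent)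
  then show ?thesis using has_derivative_inner_conormal[OF assms smooth_dF, of b a] by simp
qed

text \<open>Differentiate \<nu> \<bullet> \<xi> = 1: the term \<nu> \<bullet> D\<xi> drops out
  because D\<xi> is tangential.\<close>

lemma dconormal_normal:
  assumes "u \<in> U"
  shows "d\<nu> u a \<bullet> \<xi> u = 0"
proof -
  have "frechet_derivative (\<lambda>v. \<nu> v \<bullet> \<xi> v) (at u) = (\<lambda>_. 0)"
    by (rule frechet_derivative_constant_on[OF assms]) (rule conormal_normal)
  moreover have "dir_deriv (\<lambda>_. a) \<xi> u \<in> range (frechet_derivative F (at u))"
    using normal assms by (auto simp: affine_normal_def)
  ultimately show ?thesis
    using has_derivative_inner_conormal[OF assms smooth_\<xi>, of a] by (simp add: range_dF[OF assms] dir_deriv_def)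
qed

lemma smooth_metric: "smooth_metric U h"
proof (rule smooth_metric.intro)
  show "open U" by (rule open_dom)
  fix a b u
  have "smooth_on U (\<lambda>u. \<nu> u \<bullet> ddF u a b)"
    by (intro smooth_on_inner open_dom smooth_conormal smooth_ddF)
  then show "smooth_on U (\<lambda>u. h u a b)"
    using smooth_on_cong[OF open_dom affine_metric_eq] by simp
  assume u: "u \<in> U"
  show "linear (\<lambda>a. h u a b)"
    using ddF_linear[OF u] by (simp add: linear_iff affine_metric_eq[OF u] inner_add_right)
  show "h u a b = h u b a"
    by (simp add: affine_metric_eq[OF u] ddF_commute[OF u])
  show "nondegenerate_form (h u)"
    using normal u by (auto simp: affine_normal_def)
qed

sublocale smooth_metric U h by (rule smooth_metric)

definition cubic :: "real^'n \<Rightarrow> real^'n \<Rightarrow> real^'n \<Rightarrow> real^'n \<Rightarrow> real" where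
  "cubic u a b c = \<nu> u \<bullet> dddF u a b c + d\<nu> u a \<bullet> ddF u b c + d\<nu> u b \<bullet> ddF u a c + d\<nu> u c \<bullet> ddF u a b"

lemma cubic_commute:
  "u \<in> U \<Longrightarrow> cubic u a b c = cubic u b a c" "u \<in> U \<Longrightarrow> cubic u a b c = cubic u a c b"
  using dddF_commute[of u] ddF_commute[of u] by (auto simp: cubic_def)

lemma dg_eq:
  assumes "u \<in> U"
  shows "dg u a b c = d\<nu> u a \<bullet> ddF u b c + \<nu> u \<bullet> dddF u a b c"
proof -
  have "frechet_derivative (\<lambda>v. h v b c) (at u) = frechet_derivative (\<lambda>v. \<nu> v \<bullet> ddF v b c) (at u)"
    by (rule frechet_derivative_transform_within_open[OF _ open_dom assms affine_metric_eq])
       (use smooth_on_differentiable[OF smooth assms] in auto)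
  then show ?thesis
    unfolding dg_def using has_derivative_inner_conormal[OF assms smooth_ddF] by simp
qed

text \<open>Symmetry of h moves the derivative onto the conormal, h(z,c) = - D\<nu>(c) \<bullet>
  DF(z), and D\<nu> annihilates the \<xi>-part of the second derivative. This eliminates the induced
  connection from all later formulas.\<close>

lemma h_conn:
  assumes "u \<in> U"
  shows "h u (conn u a b) c = - (d\<nu> u c \<bullet> ddF u a b)"
proof -
  have "h u (conn u a b) c = - (d\<nu> u c \<bullet> dF u (conn u a b))"
    using sym[OF assms] dconormal_dF[OF assms] by (simp add: affine_metric_eq[OF assms])
  then show ?thesis
    by (simp add: dF_conn[OF assms] inner_diff_right dconormal_normal[OF assms])
qed

text \<open>\<open>cubic\<close> is the covariant derivative of the affine metric; the expression through the
  conormal makes its total symmetry, the Codazzi equation, evident.\<close>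

lemma cubic_eq: "u \<in> U \<Longrightarrow> cubic u a b c = dg u a b c - h u (conn u a b) c - h u (conn u a c) b"
  by (simp add: dg_eq h_conn cubic_def)

text \<open>In the Koszul expression the symmetric third derivatives leave half of \<nu> \<bullet>
  D^3F, and the term D\<nu>(c) \<bullet> D^2F(a,b) occurs with factor -1/2. Subtracting from
  \<open>h_conn\<close>, where it has factor -1, leaves -1/2 for every summand of
  \<open>cubic\<close>.\<close>

lemma difference_tensor_cubic:
  assumes "u \<in> U"
  shows "h u (difference_tensor U F \<xi> u a b) c = - cubic u a b c / 2"
proof -
  have "h u (difference_tensor U F \<xi> u a b) c = h u (conn u a b) c - koszul u a b c"
    using linear_diff[OF linear_left[OF assms]] levi_civita_koszul[OF assms]
    by (simp add: difference_tensor_def)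
  moreover have "dddF u b a c = dddF u a b c" "dddF u c a b = dddF u a b c"
    using dddF_commute[OF assms] by metis+
  ultimately show ?thesis
    by (simp add: koszul_def dg_eq[OF assms] h_conn[OF assms] cubic_def field_simps)
qed

lemma linear_cubic: "u \<in> U \<Longrightarrow> linear (\<lambda>a. cubic u a b c)"
  using ddF_linear[of u]
    linear_frechet_derivative[OF smooth_on_differentiable[OF smooth_conormal], of u]
    linear_frechet_derivative[OF smooth_on_differentiable[OF smooth_ddF], of u]
  by (simp add: cubic_def linear_iff algebra_simps)

lemma eq_zeroI:
  assumes "u \<in> U" "\<And>a. w \<bullet> dF u a = 0" "w \<bullet> \<xi> u = 0"
  shows "w = 0"
proof -
  have "w - (\<nu> u \<bullet> w) *\<^sub>R \<xi> u \<in> range (frechet_derivative F (at u))"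
    unfolding range_dF[OF assms(1)] by (simp add: inner_diff_right conormal_normal[OF assms(1)])
  then obtain z where "w = dF u z + (\<nu> u \<bullet> w) *\<^sub>R \<xi> u"
    by (auto simp: algebra_simps)
  then have "w \<bullet> w = w \<bullet> (dF u z + (\<nu> u \<bullet> w) *\<^sub>R \<xi> u)" by simp
  then show ?thesis using assms(2,3) by (simp add: inner_add_right)
qed

end

section \<open>Symmetries of order three\<close>

lemma special_isometry_group_monoid: "monoid (special_isometry_group g)"
proof (rule monoidI)
  fix L M assume LM: "L \<in> carrier (special_isometry_group g)" "M \<in> carrier (special_isometry_group g)"
  then have "linear L" "linear M" "det (matrix L) = 1" "det (matrix M) = 1"
    by (auto simp: special_isometry_group_def)
  then have "linear (L \<circ> M)" "det (matrix (L \<circ> M)) = 1"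
    by (simp_all add: linear_compose matrix_compose det_mul)
  with LM show "L \<otimes>\<^bsub>special_isometry_group g\<^esub> M \<in> carrier (special_isometry_group g)"
    by (simp add: special_isometry_group_def)
qed (auto simp: special_isometry_group_def matrix_id_mat_1 linear_id comp_assoc)

text \<open>For arbitrary g only the monoid laws are at hand; the inverses inside the subgroup are
  read off from R^3 = id.\<close>

lemma order_three_subgroup:
  fixes g :: "real^'n \<Rightarrow> real^'n \<Rightarrow> real"
  assumes R: "R \<in> carrier (special_isometry_group g)" and R3: "R \<circ> R \<circ> R = id" and "R \<noteq> id"
  shows "subgroup {id, R, R \<circ> R} (special_isometry_group g)"
    and "special_isometry_group g\<lparr>carrier := {id, R, R \<circ> R}\<rparr> \<cong> integer_mod_group 3"
proof -
  let ?G = "special_isometry_group g"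
  interpret G: monoid ?G by (rule special_isometry_group_monoid)
  have [simp]: "\<one>\<^bsub>?G\<^esub> = id" "L \<otimes>\<^bsub>?G\<^esub> M = L \<circ> M" for L M
    by (simp_all add: special_isometry_group_def)
  have RR: "R \<circ> R \<in> carrier ?G" using G.m_closed[OF R R] by simp
  have R3': "R \<circ> (R \<circ> R) = id" "R \<circ> R \<circ> (R \<circ> R) = R" 
    using R3 by (simp_all add: comp_assoc[symmetric])
  have ne: "R \<circ> R \<noteq> R" "R \<circ> R \<noteq> id" using R3 \<open>R \<noteq> id\<close> by auto
  have inv: "inv\<^bsub>?G\<^esub> id = id" "inv\<^bsub>?G\<^esub> R = R \<circ> R" "inv\<^bsub>?G\<^esub> (R \<circ> R) = R"
    using G.inv_unique' R RR R3 R3' G.one_closed by auto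
  show "subgroup {id, R, R \<circ> R} ?G"
    by (rule subgroup.intro) (use R RR G.one_closed inv R3 R3' in auto)
  define f :: "(real^'n \<Rightarrow> real^'n) \<Rightarrow> int" where
    \<comment> \<open>The default 2 is the value at R^2; outside the three elements f does not
      matter.\<close>
    "f L = (if L = id then 0 else if L = R then 1 else 2)" for L
  have f: "f id = 0" "f R = 1" "f (R \<circ> R) = 2" using ne \<open>R \<noteq> id\<close> by (auto simp: f_def)
  have "f \<in> iso (?G\<lparr>carrier := {id, R, R \<circ> R}\<rparr>) (integer_mod_group 3)"
  proof (rule isoI)
    show "f \<in> hom (?G\<lparr>carrier := {id, R, R \<circ> R}\<rparr>) (integer_mod_group 3)"
      using f R3 R3' by (auto simp: hom_def carrier_integer_mod_group)
    have "{0..<3::int} = {0, 1, 2}" by auto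
    then show "bij_betw f (carrier (?G\<lparr>carrier := {id, R, R \<circ> R}\<rparr>)) (carrier (integer_mod_group 3))"
      using f by (auto simp: bij_betw_def inj_on_def carrier_integer_mod_group)
  qed
  then show "?G\<lparr>carrier := {id, R, R \<circ> R}\<rparr> \<cong> integer_mod_group 3"
    by (auto simp: is_iso_def)
qed

section \<open>A third of a turn in the plane of the surface\<close>

definition plane_form :: "real \<Rightarrow> real \<Rightarrow> real \<Rightarrow> real^3 \<Rightarrow> real^3 \<Rightarrow> real" where
  "plane_form a b c x y = a * (x $ 2 * y $ 2) + b * (x $ 2 * y $ 3 + x $ 3 * y $ 2) + c * (x $ 3 * y $ 3)"

text \<open>Like \<open>plane_form\<close> it sees only coordinates 2 and 3, those kept by
  \<open>pr23\<close>: both are pulled back from the surface and vanish on the t-direction.\<close>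

definition plane_cubic :: "real \<Rightarrow> real \<Rightarrow> real \<Rightarrow> real \<Rightarrow> real^3 \<Rightarrow> real^3 \<Rightarrow> real^3 \<Rightarrow> real" where
  "plane_cubic p q r s x y z =
     p * (x $ 2 * y $ 2 * z $ 2) + q * (x $ 2 * y $ 2 * z $ 3 + x $ 2 * y $ 3 * z $ 2 + x $ 3 * y $ 2 * z $ 2) +
     r * (x $ 2 * y $ 3 * z $ 3 + x $ 3 * y $ 2 * z $ 3 + x $ 3 * y $ 3 * z $ 2) + s * (x $ 3 * y $ 3 * z $ 3)"

text \<open>For \<open>4 k\<^sup>2 (a c - b\<^sup>2) = 3\<close> this is the rotation by \<open>2\<pi>/3\<close> with respect to \<open>plane_form a b c\<close>:
  on the plane it is \<open>cos (2\<pi>/3) + sin (2\<pi>/3) J\<close> with \<open>J\<close> the complex structure of the form.\<close>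

definition plane_rotation :: "real \<Rightarrow> real \<Rightarrow> real \<Rightarrow> real \<Rightarrow> real^3 \<Rightarrow> real^3" where
  "plane_rotation k a b c x = vector [x $ 1, (- 1 / 2 - k * b) * x $ 2 - k * c * x $ 3,
     k * a * x $ 2 + (- 1 / 2 + k * b) * x $ 3]"

lemma plane_rotation_nth [simp]:
  "plane_rotation k a b c x $ 1 = x $ 1"
  "plane_rotation k a b c x $ 2 = (- 1 / 2 - k * b) * x $ 2 - k * c * x $ 3"
  "plane_rotation k a b c x $ 3 = k * a * x $ 2 + (- 1 / 2 + k * b) * x $ 3"
  by (simp_all add: plane_rotation_def)

lemma linear_plane_rotation: "linear (plane_rotation k a b c)"
  by (rule linearI) (simp_all add: vec_eq_iff forall_3 algebra_simps)

context
  fixes k a b c :: real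
  assumes k: "4 * k\<^sup>2 * (a * c - b\<^sup>2) = 3"
begin

text \<open>On the plane R^2 + R + 1 is the scalar (3 - 4 k^2 (a c - b^2)) / 4 by Cayley-Hamilton,
  and R^3 - 1 = (R - 1)(R^2 + R + 1). The identities below state this before the condition on k
  makes the scalar zero.\<close>

lemma plane_rotation_cube: "plane_rotation k a b c \<circ> plane_rotation k a b c \<circ> plane_rotation k a b c = id"
proof -
  let ?R = "plane_rotation k a b c"
  have "?R (?R (?R x)) $ 2 = x $ 2 - (4 * k\<^sup>2 * (a * c - b\<^sup>2) - 3) / 4 * (?R x $ 2 - x $ 2)"
    "?R (?R (?R x)) $ 3 = x $ 3 - (4 * k\<^sup>2 * (a * c - b\<^sup>2) - 3) / 4 * (?R x $ 3 - x $ 3)" for x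
    unfolding plane_rotation_nth by (simp_all add: field_simps power2_eq_square)
  then show ?thesis
    using k by (simp add: fun_eq_iff vec_eq_iff forall_3)
qed

lemma plane_rotation_neq_id: "plane_rotation k a b c \<noteq> id"
proof
  assume "plane_rotation k a b c = id"
  then have "plane_rotation k a b c (axis i 1) $ i = (axis i 1 :: real^3) $ i" for i by simp
  \<comment> \<open>The two diagonal entries of the plane block sum to -1, those of the identity to
    2.\<close>
  from this[of 2] this[of 3] show False by (simp add: axis_def)
qed

lemma det_plane_rotation: "det (matrix (plane_rotation k a b c)) = 1"
proof -
  have "det (matrix (plane_rotation k a b c)) =
      (- 1 / 2 - k * b) * (- 1 / 2 + k * b) + k * c * (k * a)"
    by (simp add: det_3 matrix_def axis_def)
  also have "\<dots> = 1 + (4 * k\<^sup>2 * (a * c - b\<^sup>2) - 3) / 4"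
    by (simp add: field_simps power2_eq_square)
  finally show ?thesis using k by simp
qed

lemma plane_form_rotation:
  "plane_form a b c (plane_rotation k a b c x) (plane_rotation k a b c y) = plane_form a b c x y"
proof -
  have "plane_form a b c (plane_rotation k a b c x) (plane_rotation k a b c y) =
      plane_form a b c x y + (4 * k\<^sup>2 * (a * c - b\<^sup>2) - 3) / 4 * plane_form a b c x y"
    unfolding plane_form_def plane_rotation_nth by (simp add: field_simps power2_eq_square)
  then show ?thesis using k by simp
qed

text \<open>A traceless cubic form is invariant because the rotation \<open>R\<close> is symmetric with respect to it,
  so that all three copies of \<open>R\<close> may be collected in one argument.\<close>

lemma plane_cubic_rotation:
  assumes "c * p - 2 * b * q + a * r = 0" "c * q - 2 * b * r + a * s = 0"
  defines "R \<equiv> plane_rotation k a b c"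
  shows "plane_cubic p q r s (R x) (R y) (R z) = plane_cubic p q r s x y z"
proof -
  have move: "plane_cubic p q r s (R x) y z = plane_cubic p q r s x (R y) z" for x y z
  proof -
    \<comment> \<open>The defect is antisymmetric in x and y, hence a multiple of the area form; its
      factor is, up to the Gram determinant, the trace of the cubic form with z in the remaining
      slot.\<close>
    have "plane_cubic p q r s (R x) y z - plane_cubic p q r s x (R y) z =
      k * (x $ 2 * y $ 3 - x $ 3 * y $ 2) *
        (z $ 2 * (c * p - 2 * b * q + a * r) + z $ 3 * (c * q - 2 * b * r + a * s))"
      unfolding plane_cubic_def R_def plane_rotation_nth by (simp add: field_simps)
    then show ?thesis using assms by simp
  qed
  have sym: "plane_cubic p q r s x y z = plane_cubic p q r s x z y" for x y z
    by (simp add: plane_cubic_def algebra_simps)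
  have "plane_cubic p q r s (R x) (R y) (R z) = plane_cubic p q r s (R (R (R x))) y z"
    using move sym by metis
  then show ?thesis
    using plane_rotation_cube by (simp add: R_def fun_eq_iff)
qed

end

text \<open>R preserves h and the trilinear form h(K(x,y),z), so nondegeneracy forces K to commute
  with R. The first coordinate is fixed by R, which takes care of the terms in \<alpha>' and
  \<beta>'.\<close>

lemma order_three_symmetry:
  fixes h :: "real^3 \<Rightarrow> real^3 \<Rightarrow> real"
  assumes pos: "a * c - b\<^sup>2 > 0"
    and h: "\<And>x y. h x y = \<alpha> * (x $ 1 * y $ 1) + \<beta> * plane_form a b c x y"
    and nondeg: "nondegenerate_form h"
    and K: "\<And>x y z. h (K x y) z = \<alpha>' * (x $ 1 * y $ 1 * z $ 1) +
        \<beta>' * (x $ 1 * plane_form a b c y z + y $ 1 * plane_form a b c x z + z $ 1 * plane_form a b c x y) +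
        \<delta> * plane_cubic p q r s x y z"
    and trace: "c * p - 2 * b * q + a * r = 0" "c * q - 2 * b * r + a * s = 0"
  shows "\<exists>S. subgroup S (special_isometry_group h) \<and>
    special_isometry_group h\<lparr>carrier := S\<rparr> \<cong> integer_mod_group 3 \<and>
    (\<forall>L\<in>S. \<forall>x y. K (L x) (L y) = L (K x y))"
proof -
  \<comment> \<open>The factor is sin (2\<pi>/3) over the square root of the Gram determinant; that
    root normalizes the matrix with rows (-b, -c), (a, b) to square -1.\<close>
  define k where "k = sqrt 3 / (2 * sqrt (a * c - b\<^sup>2))"
  have k: "4 * k\<^sup>2 * (a * c - b\<^sup>2) = 3"
    using pos by (simp add: k_def power_divide power_mult_distrib field_simps)
  define R where "R = plane_rotation k a b c"
  have R3: "R \<circ> R \<circ> R = id" unfolding R_def by (rule plane_rotation_cube[OF k])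
  have hR: "h (R x) (R y) = h x y" for x y
    using plane_form_rotation[OF k] by (simp add: h R_def)
  have R: "R \<in> carrier (special_isometry_group h)"
    using hR det_plane_rotation[OF k] by (simp add: special_isometry_group_def R_def linear_plane_rotation)
  have KR: "K (R x) (R y) = R (K x y)" for x y
  proof -
    have "h (K (R x) (R y) - R (K x y)) z = 0" for z
    proof -
      \<comment> \<open>Exhibits z as a value of R, so that invariance of h can be used with R in
        both slots.\<close>
      have z: "z = R (R (R z))" using R3 by (simp add: fun_eq_iff)
      have "h (R (K x y)) (R (R (R z))) = h (K x y) (R (R z))" by (rule hR)
      also have "\<dots> = h (K (R x) (R y)) (R (R (R z)))"
        unfolding K using plane_form_rotation[OF k] plane_cubic_rotation[OF k trace] by (simp add: R_def)
      finally have "h (K (R x) (R y)) z = h (R (K x y)) z" using z by simp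
      moreover have "h (v - w) z = h v z - h w z" for v w
        by (simp add: h plane_form_def algebra_simps)
      ultimately show ?thesis by simp
    qed
    then show ?thesis using nondeg unfolding nondegenerate_form_def by (metis eq_iff_diff_eq_0)
  qed
  have ne: "R \<noteq> id" unfolding R_def by (rule plane_rotation_neq_id[OF k])
  show ?thesis
    by (rule exI[of _ "{id, R, R \<circ> R}"]) (use order_three_subgroup[OF R R3 ne] KR in auto)
qed

section \<open>Surfaces and apolarity\<close>

lemma cross3_images_nonzero:
  fixes f :: "real^2 \<Rightarrow> real^3"
  assumes "linear f" "inj f"
  shows "cross3 (f (axis 1 1)) (f (axis 2 1)) \<noteq> 0"
proof
  assume "cross3 (f (axis 1 1)) (f (axis 2 1)) = 0"
  then have "f (axis 1 1) = 0 \<or> f (axis 2 1) = 0 \<or> (\<exists>c. f (axis 2 1) = c *\<^sub>R f (axis 1 1))"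
    by (simp add: cross_eq_0 collinear_lemma)
  then have "f (axis 1 1) = f 0 \<or> f (axis 2 1) = f 0 \<or> (\<exists>c. f (axis 2 1) = f (c *\<^sub>R axis 1 1))"
    by (simp add: linear_0[OF assms(1)] linear_cmul[OF assms(1)])
  then have "axis 1 1 = (0::real^2) \<or> axis 2 1 = (0::real^2) \<or> (\<exists>c. axis 2 1 = c *\<^sub>R (axis 1 1 :: real^2))"
    by (simp add: inj_eq[OF assms(2)])
  then show False by (auto simp: vec_eq_iff axis_def forall_2)
qed

lemma bounded_bilinear_cross3: "bounded_bilinear cross3"
  using bilinear_cross by (simp add: bilinear_conv_bounded_bilinear)

lemma linear_vec_expansion_2:
  "linear L \<Longrightarrow> L x = x $ 1 *\<^sub>R L (axis 1 1) + x $ 2 *\<^sub>R L (axis 2 1 :: real^2)"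
  using linear_vec_expansion[of L x] by (simp add: sum_2)

lemma frame_matrix_2:
  "frame_matrix (\<lambda>i::2. if i = 1 then 1 else 2 :: 3) V w = vector [V 1, V 2, w]"
proof -
  let ?e = "\<lambda>i::2. if i = 1 then 1 else 2 :: 3"
  have inj: "inj ?e" by (auto simp: inj_def split: if_splits) (metis exhaust_2)
  have "the_inv ?e (?e 1) = 1" "the_inv ?e (?e 2) = 2"
    by (rule the_inv_f_f[OF inj])+
  then have 1: "the_inv ?e 1 = 1" "the_inv ?e 2 = 2" by simp_all
  have 2: "range ?e = {1, 2}" by (auto simp: UNIV_2)
  show ?thesis unfolding frame_matrix_def 2 by (simp add: vec_eq_iff forall_3 1)
qed

locale conormal_surface = conormal_hypersurface U F \<xi> \<nu>
  for U :: "(real^2) set" and F \<xi> \<nu> :: "real^2 \<Rightarrow> real^3"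
begin

definition area :: "real^2 \<Rightarrow> real" where
  "area u = cross3 (dF u (axis 1 1)) (dF u (axis 2 1)) \<bullet> \<xi> u"

definition gram_det :: "real^2 \<Rightarrow> real" where
  "gram_det u = h u (axis 1 1) (axis 1 1) * h u (axis 2 1) (axis 2 1) - (h u (axis 1 1) (axis 2 1))\<^sup>2"

text \<open>Both sides agree on tangent vectors and on \<xi>. It lets the conormal replace cross
  products, here and in the four-dimensional determinant.\<close>

lemma area_conormal:
  assumes "u \<in> U"
  shows "cross3 (dF u (axis 1 1)) (dF u (axis 2 1)) = area u *\<^sub>R \<nu> u"
proof -
  have "(cross3 (dF u (axis 1 1)) (dF u (axis 2 1)) - area u *\<^sub>R \<nu> u) \<bullet> dF u a = 0" for a
    unfolding inner_diff_left inner_scaleR_left conormal_tangent[OF assms]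
    by (subst linear_vec_expansion_2[OF linear_dF[OF assms], of a])
       (simp add: inner_add_right dot_cross_self)
  moreover have "(cross3 (dF u (axis 1 1)) (dF u (axis 2 1)) - area u *\<^sub>R \<nu> u) \<bullet> \<xi> u = 0"
    by (simp add: inner_diff_left conormal_normal[OF assms] area_def)
  ultimately show ?thesis using eq_zeroI[OF assms] by (metis eq_iff_diff_eq_0)
qed

lemma area_nonzero: 
  assumes "u \<in> U" shows "area u \<noteq> 0"
  using area_conormal[OF assms] cross3_images_nonzero[OF linear_dF[OF assms]] immersed assms
  by (auto simp: immersed_hypersurface_def)

lemma area_square:
  assumes "u \<in> U"
  shows "(area u)\<^sup>2 = \<bar>gram_det u\<bar>"
proof -
  let ?e = "\<lambda>i::2. if i = 1 then 1 else 2 :: 3" and ?X = "\<lambda>i::2. axis i 1 :: real^2"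
  have inj: "inj ?e" by (auto simp: inj_def split: if_splits) (metis exhaust_2)
  have "\<bar>det (frame_matrix ?e (\<lambda>i. dF u (?X i)) (\<xi> u))\<bar> = sqrt \<bar>det (\<chi> i j. h u (?X i) (?X j))\<bar>"
    by (rule volume[OF assms inj])
  moreover have "det (frame_matrix ?e (\<lambda>i. dF u (?X i)) (\<xi> u)) = area u"
    unfolding frame_matrix_2 area_def
    by (subst inner_commute) (simp add: det_3 cross3_def inner_vec_def sum_3 algebra_simps)
  moreover have "det (\<chi> i j. h u (?X i) (?X j)) = gram_det u"
    using sym[OF assms, of "axis 2 1" "axis 1 1"] by (simp add: det_2 gram_det_def power2_eq_square)
  ultimately have "\<bar>area u\<bar> = sqrt \<bar>gram_det u\<bar>" by simp
  then have "\<bar>area u\<bar>\<^sup>2 = \<bar>gram_det u\<bar>" by simp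
  then show ?thesis by simp
qed

text \<open>The induced connection is parallel for the volume form: D\<xi> is tangential, so it
  contributes nothing, and of the differentiated frame vectors only the diagonal coefficients of the
  connection survive in the determinant.\<close>

lemma has_derivative_area:
  assumes "u \<in> U"
  shows "(area has_derivative (\<lambda>a. (conn u a (axis 1 1) $ 1 + conn u a (axis 2 1) $ 2) * area u)) (at u)"
proof -
  let ?P = "dF u (axis 1 1)" and ?Q = "dF u (axis 2 1)"
  note d = smooth_on_has_derivative[OF smooth_dF assms]
  have "(area has_derivative (\<lambda>a. cross3 ?P ?Q \<bullet> frechet_derivative \<xi> (at u) a +
      (cross3 ?P (ddF u a (axis 2 1)) + cross3 (ddF u a (axis 1 1)) ?Q) \<bullet> \<xi> u)) (at u)"
    unfolding area_def[abs_def]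
    by (intro has_derivative_inner bounded_bilinear.FDERIV[OF bounded_bilinear_cross3] d
        smooth_on_has_derivative[OF smooth_\<xi> assms])
  moreover have "cross3 ?P ?Q \<bullet> frechet_derivative \<xi> (at u) a +
      (cross3 ?P (ddF u a (axis 2 1)) + cross3 (ddF u a (axis 1 1)) ?Q) \<bullet> \<xi> u =
      (conn u a (axis 1 1) $ 1 + conn u a (axis 2 1) $ 2) * area u" for a
  proof -
    have "dir_deriv (\<lambda>_. a) \<xi> u \<in> range (frechet_derivative F (at u))"
      using normal assms by (auto simp: affine_normal_def)
    then have 1: "\<nu> u \<bullet> frechet_derivative \<xi> (at u) a = 0"
      by (simp add: range_dF[OF assms] dir_deriv_def)
    have dd: "ddF u a b = conn u a b $ 1 *\<^sub>R ?P + conn u a b $ 2 *\<^sub>R ?Q + h u a b *\<^sub>R \<xi> u" for b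
      using dF_conn[OF assms, of a b] linear_vec_expansion_2[OF linear_dF[OF assms], of "conn u a b"]
      by (simp add: algebra_simps)
    have "cross3 ?P (ddF u a (axis 2 1)) \<bullet> \<xi> u = conn u a (axis 2 1) $ 2 * area u"
      "cross3 (ddF u a (axis 1 1)) ?Q \<bullet> \<xi> u = conn u a (axis 1 1) $ 1 * area u"
      unfolding dd area_def
      by (simp_all add: cross_add_left cross_add_right cross_mult_left cross_mult_right inner_add_left dot_cross_self)
    then show ?thesis
      using 1 by (simp add: area_conormal[OF assms] inner_add_left algebra_simps)
  qed
  ultimately show ?thesis by simp
qed

text \<open>Apolarity. It is the logarithmic derivative of \<open>area\<^sup>4 = gram_det\<^sup>2\<close>, the volume condition
  freed of its absolute value.\<close>

lemma cubic_trace: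
  assumes "u \<in> U"
  shows "h u (axis 2 1) (axis 2 1) * cubic u a (axis 1 1) (axis 1 1)
    - 2 * h u (axis 1 1) (axis 2 1) * cubic u a (axis 1 1) (axis 2 1)
    + h u (axis 1 1) (axis 1 1) * cubic u a (axis 2 1) (axis 2 1) = 0"
proof -
  let ?e = "axis 1 1 :: real^2" and ?f = "axis 2 1 :: real^2"
  define tr where "tr a = conn u a ?e $ 1 + conn u a ?f $ 2" for a
  define dD where "dD a = dg u a ?e ?e * h u ?f ?f + h u ?e ?e * dg u a ?f ?f - 2 * h u ?e ?f * dg u a ?e ?f" for a
  have pow: "(gram_det v)\<^sup>2 = (area v) ^ 4" if "v \<in> U" for v
  proof -
    have "(area v) ^ 4 = ((area v)\<^sup>2)\<^sup>2" by simp
    then show ?thesis unfolding area_square[OF that] by simp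
  qed
  have "((\<lambda>v. (area v) ^ 4) has_derivative (\<lambda>a. 4 * (tr a * area u) * area u ^ 3)) (at u)"
    using has_derivative_power[OF has_derivative_area[OF assms], of 4] by (simp add: tr_def)
  then have A: "((\<lambda>v. (gram_det v)\<^sup>2) has_derivative (\<lambda>a. 4 * (tr a * area u) * area u ^ 3)) (at u)"
    by (rule has_derivative_transform_within_open[OF _ open_dom assms]) (simp add: pow)
  have "(gram_det has_derivative dD) (at u)"
    unfolding gram_det_def[abs_def] dD_def[abs_def]
    by (auto intro!: derivative_eq_intros has_derivative_g[OF assms] simp: fun_eq_iff algebra_simps)
  from has_derivative_unique[OF A has_derivative_power[OF this, of 2]]
  have "4 * (tr a * area u) * area u ^ 3 = 2 * dD a * gram_det u" by (simp add: fun_eq_iff)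
  then have "4 * tr a * area u ^ 4 = 2 * dD a * gram_det u" by (simp add: eval_nat_numeral algebra_simps)
  then have "gram_det u * (2 * tr a * gram_det u) = gram_det u * dD a"
    unfolding pow[OF assms, symmetric] by (simp add: power2_eq_square algebra_simps)
  moreover have "gram_det u \<noteq> 0" using pow[OF assms] area_nonzero[OF assms] by auto
  ultimately have dD: "dD a = 2 * tr a * gram_det u" by simp
  have hc: "h u (conn u a b) c = conn u a b $ 1 * h u ?e c + conn u a b $ 2 * h u ?f c" for b c
    using linear_vec_expansion_2[OF linear_left[OF assms], of "conn u a b" c] by simp
  show ?thesis
    \<comment> \<open>By \<open>cubic_eq\<close> the left-hand side is dD a - 2 tr a gram_det: the
      connection terms, weighted by the adjugate of the Gram matrix, collapse to its trace.\<close>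
    using dD sym[OF assms, of ?f ?e]
    unfolding cubic_eq[OF assms] hc dD_def tr_def gram_det_def
    by (simp add: algebra_simps power2_eq_square)
qed

lemma h_expansion:
  assumes "u \<in> U"
  shows "h u x y = h u (axis 1 1) (axis 1 1) * (x $ 1 * y $ 1) +
    h u (axis 1 1) (axis 2 1) * (x $ 1 * y $ 2 + x $ 2 * y $ 1) +
    h u (axis 2 1) (axis 2 1) * (x $ 2 * y $ 2)"
  using linear_vec_expansion_2[OF linear_left[OF assms], of x y] sym[OF assms, of "axis 2 1" "axis 1 1"]
    linear_vec_expansion_2[OF linear_right[OF assms], of "axis 1 1" y]
    linear_vec_expansion_2[OF linear_right[OF assms], of "axis 2 1" y]
  by (simp add: algebra_simps)

lemma cubic_expansion:
  assumes "u \<in> U"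
  defines "e \<equiv> axis 1 1" and "f \<equiv> axis 2 1"
  shows "cubic u x y z = cubic u e e e * (x $ 1 * y $ 1 * z $ 1) +
    cubic u e e f * (x $ 1 * y $ 1 * z $ 2 + x $ 1 * y $ 2 * z $ 1 + x $ 2 * y $ 1 * z $ 1) +
    cubic u e f f * (x $ 1 * y $ 2 * z $ 2 + x $ 2 * y $ 1 * z $ 2 + x $ 2 * y $ 2 * z $ 1) +
    cubic u f f f * (x $ 2 * y $ 2 * z $ 2)"
proof -
  note c = cubic_commute[OF assms(1)]
  have 1: "cubic u w y z = w $ 1 * cubic u e y z + w $ 2 * cubic u f y z" for w y z
    using linear_vec_expansion_2[OF linear_cubic[OF assms(1)], of w] by (simp add: e_def f_def)
  have 2: "cubic u w y z = y $ 1 * cubic u w e z + y $ 2 * cubic u w f z" for w y z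
    using 1 c(1) by metis
  have 3: "cubic u w y z = z $ 1 * cubic u w y e + z $ 2 * cubic u w y f" for w y z
    using 2 c(2) by metis
  have p: "cubic u e f e = cubic u e e f" "cubic u f e e = cubic u e e f"
    "cubic u f e f = cubic u e f f" "cubic u f f e = cubic u e f f"
    using c by metis+
  show ?thesis
    unfolding 1[of x] 2[of _ y] 3[of _ _ z] p by (simp add: algebra_simps)
qed

end

text \<open>The cross product of the coordinate tangents annihilates the tangent plane; since \<xi>
  is transversal, dividing by its pairing with \<xi> is possible and smooth.\<close>

lemma surface_conormal_exists:
  fixes F \<xi> :: "real^2 \<Rightarrow> real^3"
  assumes imm: "immersed_hypersurface U F" and nor: "affine_normal U F \<xi>"
  shows "\<exists>\<nu>. conormal_surface U F \<xi> \<nu>"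
proof -
  let ?D = "\<lambda>u. frechet_derivative F (at u)"
  define q where "q u = cross3 (?D u (axis 1 1)) (?D u (axis 2 1))" for u
  have U: "open U" and F: "smooth_on U F" and inj: "\<And>u. u \<in> U \<Longrightarrow> inj (?D u)"
    using imm by (auto simp: immersed_hypersurface_def)
  have lin: "linear (?D u)" if "u \<in> U" for u
    using linear_frechet_derivative[OF smooth_on_differentiable[OF F that]] .
  have tangent: "q u \<bullet> ?D u a = 0" if "u \<in> U" for u a
    unfolding q_def by (subst linear_vec_expansion_2[OF lin[OF that], of a])
      (simp add: inner_add_right dot_cross_self)
  have transversal: "q u \<bullet> \<xi> u \<noteq> 0" if u: "u \<in> U" for u
  proof -
    have "range (?D u) = {y. q u \<bullet> y = 0}"
      using cross3_images_nonzero[OF lin[OF u] inj[OF u]] tangent[OF u]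
      by (intro range_eq_hyperplane lin inj u) (auto simp: q_def)
    moreover have "\<xi> u \<notin> range (?D u)" using nor u by (auto simp: affine_normal_def)
    ultimately show ?thesis by auto
  qed
  have q: "smooth_on U q"
    unfolding q_def[abs_def]
    by (intro smooth_on_bilinear[OF bounded_bilinear_cross3] smooth_on_frechet_derivative U F)
  have \<xi>: "smooth_on U \<xi>" using nor by (simp add: affine_normal_def)
  show ?thesis
  proof (rule exI)
    show "conormal_surface U F \<xi> (\<lambda>u. inverse (q u \<bullet> \<xi> u) *\<^sub>R q u)"
      unfolding conormal_surface_def
    proof
      show "smooth_on U (\<lambda>u. inverse (q u \<bullet> \<xi> u) *\<^sub>R q u)"
        using transversal by (intro smooth_on_scaleR smooth_on_inverse smooth_on_inner U q \<xi>)
    qed (use imm nor tangent transversal in auto)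
  qed
qed

section \<open>Warped hypersurfaces\<close>

lemma det_4:
  "det (A::'a::comm_ring_1^4^4) =
    A$1$1 * (A$2$2 * A$3$3 * A$4$4 + A$2$3 * A$3$4 * A$4$2 + A$2$4 * A$3$2 * A$4$3
      - A$2$2 * A$3$4 * A$4$3 - A$2$3 * A$3$2 * A$4$4 - A$2$4 * A$3$3 * A$4$2) -
    A$2$1 * (A$1$2 * A$3$3 * A$4$4 + A$1$3 * A$3$4 * A$4$2 + A$1$4 * A$3$2 * A$4$3
      - A$1$2 * A$3$4 * A$4$3 - A$1$3 * A$3$2 * A$4$4 - A$1$4 * A$3$3 * A$4$2) +
    A$3$1 * (A$1$2 * A$2$3 * A$4$4 + A$1$3 * A$2$4 * A$4$2 + A$1$4 * A$2$2 * A$4$3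
      - A$1$2 * A$2$4 * A$4$3 - A$1$3 * A$2$2 * A$4$4 - A$1$4 * A$2$3 * A$4$2) -
    A$4$1 * (A$1$2 * A$2$3 * A$3$4 + A$1$3 * A$2$4 * A$3$2 + A$1$4 * A$2$2 * A$3$3
      - A$1$2 * A$2$4 * A$3$3 - A$1$3 * A$2$2 * A$3$4 - A$1$4 * A$2$3 * A$3$2)"
proof -
  have f1: "finite {2::4, 3, 4}" "1 \<notin> {2::4, 3, 4}" by auto
  have f2: "finite {3::4, 4}" "2 \<notin> {3::4, 4}" by auto
  have f3: "finite {4::4}" "3 \<notin> {4::4}" by auto
  show ?thesis
    unfolding det_def UNIV_4
    unfolding sum_over_permutations_insert[OF f1]
    unfolding sum_over_permutations_insert[OF f2]
    unfolding sum_over_permutations_insert[OF f3]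
    unfolding permutes_sing
    by (simp add: sign_swap_id permutation_swap_id permutation_compose sign_compose sign_id swap_id_eq algebra_simps)
qed

lemma vector_4:
  "(vector [a, b, c, d] :: 'a::zero^4) $ 1 = a" "(vector [a, b, c, d] :: 'a::zero^4) $ 2 = b"
  "(vector [a, b, c, d] :: 'a::zero^4) $ 3 = c" "(vector [a, b, c, d] :: 'a::zero^4) $ 4 = d"
  unfolding vector_def by simp_all

lemma frame_matrix_3:
  "frame_matrix (\<lambda>i::3. if i = 1 then 1 else if i = 2 then 2 else 3 :: 4) V w = vector [V 1, V 2, V 3, w]"
  and inj_frame_3: "inj (\<lambda>i::3. if i = 1 then 1 else if i = 2 then 2 else 3 :: 4)"
proof -
  let ?e = "\<lambda>i::3. if i = 1 then 1 else if i = 2 then 2 else 3 :: 4"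
  show inj: "inj ?e" by (auto simp: inj_def split: if_splits) (metis exhaust_3)
  have "the_inv ?e (?e 1) = 1" "the_inv ?e (?e 2) = 2" "the_inv ?e (?e 3) = 3"
    by (rule the_inv_f_f[OF inj])+
  then have 1: "the_inv ?e 1 = 1" "the_inv ?e 2 = 2" "the_inv ?e 3 = 3" by simp_all
  have 2: "range ?e = {1, 2, 3}" unfolding UNIV_3 by (simp add: insert_commute)
  show "frame_matrix ?e V w = vector [V 1, V 2, V 3, w]"
    unfolding frame_matrix_def 2 by (simp add: vec_eq_iff forall_4 1 vector_4)
qed

section \<open>The splitting of R^4 as R x R^3\<close>

definition emb :: "real \<Rightarrow> real^3 \<Rightarrow> real^4" where
  "emb r y = vector [r, y $ 1, y $ 2, y $ 3]"

lemma emb_nth: "emb r y $ 1 = r" "emb r y $ 2 = y $ 1" "emb r y $ 3 = y $ 2" "emb r y $ 4 = y $ 3"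
  by (simp_all add: emb_def vector_4)

lemma inner_emb: "emb r y \<bullet> emb r' y' = r * r' + y \<bullet> y'"
  by (simp add: inner_vec_def sum_3 sum_4 emb_nth)

lemma emb_eq_iff: "emb r y = emb r' y' \<longleftrightarrow> r = r' \<and> y = y'"
  by (auto simp: vec_eq_iff forall_3 forall_4 emb_nth)

lemma emb_zero: "emb 0 0 = 0"
  by (simp add: vec_eq_iff forall_4 emb_nth)

lemma emb_surj: "\<exists>r y. v = emb r y"
  by (rule exI[of _ "v $ 1"], rule exI[of _ "vector [v $ 2, v $ 3, v $ 4]"])
     (simp add: vec_eq_iff forall_4 emb_nth)

lemma bounded_linear_emb: "bounded_linear (\<lambda>p. emb (fst p) (snd p))"
  unfolding linear_conv_bounded_linear[symmetric]
  by (rule linearI) (simp_all add: vec_eq_iff forall_4 emb_nth)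

lemma has_derivative_emb:
  "(f has_derivative f') (at u) \<Longrightarrow> (k has_derivative k') (at u) \<Longrightarrow>
    ((\<lambda>v. emb (f v) (k v)) has_derivative (\<lambda>a. emb (f' a) (k' a))) (at u)"
  using bounded_linear.has_derivative[OF bounded_linear_emb has_derivative_Pair] by fastforce

lemma smooth_on_emb:
  assumes "open U" "smooth_on U f" "smooth_on U k"
  shows "smooth_on U (\<lambda>v. emb (f v) (k v))"
proof (rule smooth_on_vec[OF assms(1)])
  show "smooth_on U (\<lambda>v. emb (f v) (k v) $ i)" for i
    using exhaust_4[of i] assms(2) smooth_on_component[OF assms(1,3)] by (auto simp: emb_nth)
qed

lemma det_emb:
  "det (vector [emb r P, emb 0 A, emb 0 B, emb x y] :: real^4^4) =
    r * (cross3 A B \<bullet> y) - x * (cross3 A B \<bullet> P)"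
  by (simp add: det_4 vector_4 emb_nth cross3_def inner_vec_def sum_3 algebra_simps)

lemma pr23_nth [simp]: "pr23 u $ 1 = u $ 2" "pr23 u $ 2 = u $ 3"
  by (simp_all add: pr23_def)

lemma bounded_linear_pr23: "bounded_linear pr23"
  unfolding linear_conv_bounded_linear[symmetric]
  by (rule linearI) (simp_all add: vec_eq_iff forall_2)

lemma pr23_axis: "pr23 (axis 1 1) = 0" "pr23 (axis 2 1) = axis 1 1" "pr23 (axis 3 1) = axis 2 1"
  by (simp_all add: vec_eq_iff forall_2 axis_def)

lemma smooth_on_deriv:
  fixes f :: "real \<Rightarrow> real"
  assumes "open I" "smooth_on I f"
  shows "smooth_on I (deriv f)" "t \<in> I \<Longrightarrow> (f has_derivative (\<lambda>r. r * deriv f t)) (at t)"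
proof -
  have d: "(f has_derivative (\<lambda>r. r * deriv f t)) (at t)" if "t \<in> I" for t
    using smooth_on_differentiable[OF assms(2) that] DERIV_deriv_iff_real_differentiable[of f t]
    by (simp add: has_field_derivative_def mult_commute_abs)
  then show "t \<in> I \<Longrightarrow> (f has_derivative (\<lambda>r. r * deriv f t)) (at t)" .
  have "frechet_derivative f (at t) 1 = deriv f t" if "t \<in> I" for t
    using frechet_derivative_eqI[OF d[OF that]] by simp
  from smooth_on_cong[OF assms(1) this] smooth_on_frechet_derivative[OF assms(2), of 1]
  show "smooth_on I (deriv f)" by simp
qed

text \<open>A single product chart: \<psi> is the surface in a chart with conormal n, and p, q are
  the components of \<gamma>.\<close>

locale warped =
  fixes V :: "(real^2) set" and \<psi> n :: "real^2 \<Rightarrow> real^3" and \<epsilon> :: real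
    and I :: "real set" and p q :: "real \<Rightarrow> real" and \<xi> :: "real^3 \<Rightarrow> real^4"
    and W :: "(real^3) set" and F :: "real^3 \<Rightarrow> real^4"
  assumes eps: "\<epsilon> * \<epsilon> = 1"
    and surface: "conormal_surface V \<psi> (\<lambda>v. - (\<epsilon> *\<^sub>R \<psi> v)) n"
    and open_I: "open I" and smooth_p: "smooth_on I p" and smooth_q: "smooth_on I q"
    and W_def: "W = {u. u $ 1 \<in> I \<and> pr23 u \<in> V}"
    and F_def: "F = (\<lambda>u. emb (p (u $ 1)) (q (u $ 1) *\<^sub>R \<psi> (pr23 u)))"
    and immersed: "immersed_hypersurface W F"
    and normal: "affine_normal W F \<xi>"
begin

sublocale S: conormal_surface V \<psi> "\<lambda>v. - (\<epsilon> *\<^sub>R \<psi> v)" n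
  by (rule surface)

abbreviation "p1 \<equiv> deriv p"
abbreviation "p2 \<equiv> deriv (deriv p)"
abbreviation "p3 \<equiv> deriv (deriv (deriv p))"
abbreviation "q1 \<equiv> deriv q"
abbreviation "q2 \<equiv> deriv (deriv q)"
abbreviation "q3 \<equiv> deriv (deriv (deriv q))"

lemma eps_cancel: "\<epsilon> * (\<epsilon> * x) = x"
  by (simp add: eps flip: mult.assoc)

lemma inW: "u \<in> W \<Longrightarrow> u $ 1 \<in> I" "u \<in> W \<Longrightarrow> pr23 u \<in> V"
  by (auto simp: W_def)

lemma open_W: "open W"
  using immersed by (simp add: immersed_hypersurface_def)

lemma smooth_profile: "smooth_on I f \<Longrightarrow> smooth_on W (\<lambda>u. f (u $ 1))"
  by (rule smooth_on_compose_linear[OF bounded_linear_vec_nth open_I open_W]) (simp_all add: inW)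

lemma smooth_base: "smooth_on V f \<Longrightarrow> smooth_on W (\<lambda>u. f (pr23 u))"
  by (rule smooth_on_compose_linear[OF bounded_linear_pr23 S.open_dom open_W]) (simp_all add: inW)

lemma has_derivative_profile:
  fixes f :: "real \<Rightarrow> real"
  assumes "u \<in> W" "smooth_on I f"
  shows "((\<lambda>u. f (u $ 1)) has_derivative (\<lambda>a. a $ 1 * deriv f (u $ 1))) (at u)"
  using has_derivative_compose[OF bounded_linear_imp_has_derivative[OF bounded_linear_vec_nth]
      smooth_on_deriv(2)[OF open_I assms(2) inW(1)[OF assms(1)]]] .

lemma has_derivative_base:
  assumes "u \<in> W" "smooth_on V f"
  shows "((\<lambda>u. f (pr23 u)) has_derivative (\<lambda>a. frechet_derivative f (at (pr23 u)) (pr23 a))) (at u)"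
  using has_derivative_compose[OF bounded_linear_imp_has_derivative[OF bounded_linear_pr23]
      smooth_on_has_derivative[OF assms(2) inW(2)[OF assms(1)]]] .

lemmas smooth_p123 = smooth_p smooth_on_deriv(1)[OF open_I smooth_p]
  smooth_on_deriv(1)[OF open_I smooth_on_deriv(1)[OF open_I smooth_p]]
lemmas smooth_q123 = smooth_q smooth_on_deriv(1)[OF open_I smooth_q]
  smooth_on_deriv(1)[OF open_I smooth_on_deriv(1)[OF open_I smooth_q]]

lemma dF_eq:
  assumes u: "u \<in> W"
  shows "frechet_derivative F (at u) a =
    emb (a $ 1 * p1 (u $ 1)) ((a $ 1 * q1 (u $ 1)) *\<^sub>R \<psi> (pr23 u) + q (u $ 1) *\<^sub>R S.dF (pr23 u) (pr23 a))"
  unfolding F_def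
  by (subst frechet_derivative_eqI[OF has_derivative_emb[OF has_derivative_profile[OF u smooth_p]
          has_derivative_scaleR[OF has_derivative_profile[OF u smooth_q] has_derivative_base[OF u S.smooth_F]]]])
     (simp add: algebra_simps)

lemma ddF_eq:
  assumes u: "u \<in> W"
  shows "frechet_derivative (\<lambda>v. frechet_derivative F (at v) b) (at u) a =
    emb (a $ 1 * b $ 1 * p2 (u $ 1))
      ((a $ 1 * b $ 1 * q2 (u $ 1)) *\<^sub>R \<psi> (pr23 u) + (b $ 1 * q1 (u $ 1)) *\<^sub>R S.dF (pr23 u) (pr23 a)
       + (a $ 1 * q1 (u $ 1)) *\<^sub>R S.dF (pr23 u) (pr23 b) + q (u $ 1) *\<^sub>R S.ddF (pr23 u) (pr23 a) (pr23 b))"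
    (is "_ = ?D a")
proof -
  have "((\<lambda>u. emb (b $ 1 * p1 (u $ 1)) ((b $ 1 * q1 (u $ 1)) *\<^sub>R \<psi> (pr23 u) + q (u $ 1) *\<^sub>R S.dF (pr23 u) (pr23 b)))
      has_derivative ?D) (at u)"
    by (rule has_derivative_eq_rhs[OF has_derivative_emb[OF
            has_derivative_mult_right[OF has_derivative_profile[OF u smooth_p123(2)]]
            has_derivative_add[OF
              has_derivative_scaleR[OF has_derivative_mult_right[OF has_derivative_profile[OF u smooth_q123(2)]]
                has_derivative_base[OF u S.smooth_F]]
              has_derivative_scaleR[OF has_derivative_profile[OF u smooth_q]
                has_derivative_base[OF u S.smooth_dF]]]]])
       (simp add: fun_eq_iff emb_eq_iff algebra_simps)
  from has_derivative_transform_within_open[OF this open_W u dF_eq[symmetric]]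
  show ?thesis by (simp add: frechet_derivative_eqI)
qed

lemma dddF_eq:
  assumes u: "u \<in> W"
  shows "frechet_derivative (\<lambda>v. frechet_derivative (\<lambda>v. frechet_derivative F (at v) c) (at v) b) (at u) a =
    emb (a $ 1 * b $ 1 * c $ 1 * p3 (u $ 1))
      ((a $ 1 * b $ 1 * c $ 1 * q3 (u $ 1)) *\<^sub>R \<psi> (pr23 u)
       + q2 (u $ 1) *\<^sub>R ((b $ 1 * c $ 1) *\<^sub>R S.dF (pr23 u) (pr23 a) + (a $ 1 * c $ 1) *\<^sub>R S.dF (pr23 u) (pr23 b)
         + (a $ 1 * b $ 1) *\<^sub>R S.dF (pr23 u) (pr23 c))
       + q1 (u $ 1) *\<^sub>R (c $ 1 *\<^sub>R S.ddF (pr23 u) (pr23 a) (pr23 b) + b $ 1 *\<^sub>R S.ddF (pr23 u) (pr23 a) (pr23 c)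
         + a $ 1 *\<^sub>R S.ddF (pr23 u) (pr23 b) (pr23 c))
       + q (u $ 1) *\<^sub>R S.dddF (pr23 u) (pr23 a) (pr23 b) (pr23 c))"
    (is "_ = ?D a")
proof -
  have "((\<lambda>u. emb (b $ 1 * c $ 1 * p2 (u $ 1))
      ((b $ 1 * c $ 1 * q2 (u $ 1)) *\<^sub>R \<psi> (pr23 u) + (c $ 1 * q1 (u $ 1)) *\<^sub>R S.dF (pr23 u) (pr23 b)
       + (b $ 1 * q1 (u $ 1)) *\<^sub>R S.dF (pr23 u) (pr23 c) + q (u $ 1) *\<^sub>R S.ddF (pr23 u) (pr23 b) (pr23 c)))
      has_derivative ?D) (at u)"
    by (rule has_derivative_eq_rhs[OF has_derivative_emb[OF
            has_derivative_mult_right[OF has_derivative_profile[OF u smooth_p123(3)]]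
            has_derivative_add[OF has_derivative_add[OF has_derivative_add[OF
              has_derivative_scaleR[OF has_derivative_mult_right[OF has_derivative_profile[OF u smooth_q123(3)]]
                has_derivative_base[OF u S.smooth_F]]
              has_derivative_scaleR[OF has_derivative_mult_right[OF has_derivative_profile[OF u smooth_q123(2)]]
                has_derivative_base[OF u S.smooth_dF]]]
              has_derivative_scaleR[OF has_derivative_mult_right[OF has_derivative_profile[OF u smooth_q123(2)]]
                has_derivative_base[OF u S.smooth_dF]]]
              has_derivative_scaleR[OF has_derivative_profile[OF u smooth_q]
                has_derivative_base[OF u S.smooth_ddF]]]]])
       (simp add: fun_eq_iff emb_eq_iff algebra_simps)
  from has_derivative_transform_within_open[OF this open_W u ddF_eq[symmetric]]
  show ?thesis by (simp add: frechet_derivative_eqI)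
qed

text \<open>The position vector is, up to sign, the affine normal, so its pairing with the conormal
  is constant; every cancellation between the t-direction and the surface rests on this.\<close>

lemma n_\<psi>: "v \<in> V \<Longrightarrow> n v \<bullet> \<psi> v = - \<epsilon>"
proof -
  assume "v \<in> V"
  then have "\<epsilon> * (n v \<bullet> \<psi> v) = - 1" using S.conormal_normal[of v] by simp
  then have "\<epsilon> * \<epsilon> * (n v \<bullet> \<psi> v) = - \<epsilon>" by (simp add: mult.assoc)
  then show ?thesis by (simp add: eps)
qed

lemma dn_\<psi>: "v \<in> V \<Longrightarrow> S.d\<nu> v a \<bullet> \<psi> v = 0"
  using S.dconormal_normal[of v a] eps by auto

definition \<nu>0 :: "real^3 \<Rightarrow> real^4" where
  "\<nu>0 u = emb (q1 (u $ 1)) ((\<epsilon> * p1 (u $ 1)) *\<^sub>R n (pr23 u))"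

definition s :: "real^3 \<Rightarrow> real" where
  "s u = \<nu>0 u \<bullet> \<xi> u"

definition \<nu> :: "real^3 \<Rightarrow> real^4" where
  "\<nu> u = inverse (s u) *\<^sub>R \<nu>0 u"

text \<open>Up to sign the numerator of the curvature of \<gamma>; it is the t-part of the metric
  before division by s.\<close>

definition w :: "real \<Rightarrow> real" where
  "w t = q1 t * p2 t - p1 t * q2 t"

lemma smooth_\<nu>0: "smooth_on W \<nu>0"
  unfolding \<nu>0_def[abs_def]
  by (intro smooth_on_emb smooth_on_scaleR smooth_on_mult smooth_on_const smooth_base open_W
      smooth_profile smooth_p123 smooth_q123 S.smooth_conormal)

lemma smooth_s: "smooth_on W s"
  unfolding s_def[abs_def] using normal
  by (intro smooth_on_inner open_W smooth_\<nu>0) (simp add: affine_normal_def)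

lemma \<nu>0_tangent: "u \<in> W \<Longrightarrow> \<nu>0 u \<bullet> frechet_derivative F (at u) a = 0"
  using eps by (simp add: dF_eq \<nu>0_def inner_emb inner_add_right n_\<psi> S.conormal_tangent inW algebra_simps)

text \<open>If \<nu>0 vanished, so would the velocity of \<gamma>, and with it the t-derivative of
  F, against immersion. A nonzero \<nu>0 has the tangent space as its kernel, and \<xi> is
  transversal to that.\<close>

lemma s_nonzero:
  assumes u: "u \<in> W" shows "s u \<noteq> 0"
proof -
  let ?D = "frechet_derivative F (at u)"
  have F: "smooth_on W F" and inj: "inj ?D" using immersed u by (auto simp: immersed_hypersurface_def)
  have lin: "linear ?D"
    using linear_frechet_derivative[OF smooth_on_differentiable[OF F u]] .
  have "\<nu>0 u \<noteq> 0"
  proof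
    assume "\<nu>0 u = 0"
    then have "q1 (u $ 1) = 0" "(\<epsilon> * p1 (u $ 1)) *\<^sub>R n (pr23 u) = 0"
      by (simp_all add: \<nu>0_def emb_eq_iff flip: emb_zero)
    moreover have "n (pr23 u) \<noteq> 0" using S.conormal_normal[OF inW(2)[OF u]] by auto
    ultimately have "q1 (u $ 1) = 0" "p1 (u $ 1) = 0" using eps by auto
    then have "?D (axis 1 1) = 0"
      using linear_0[OF S.linear_dF[OF inW(2)[OF u]]] by (simp add: dF_eq[OF u] pr23_axis emb_zero)
    then have "axis 1 1 = (0 :: real^3)"
      using inj linear_0[OF lin] by (metis injD)
    then show False by (simp add: axis_eq_0_iff)
  qed
  then have "range ?D = {y. \<nu>0 u \<bullet> y = 0}"
    using \<nu>0_tangent[OF u] by (intro range_eq_hyperplane lin inj) auto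
  moreover have "\<xi> u \<notin> range ?D" using normal u by (auto simp: affine_normal_def)
  ultimately show ?thesis by (auto simp: s_def)
qed

sublocale C: conormal_hypersurface W F \<xi> \<nu>
proof
  show "smooth_on W \<nu>"
    unfolding \<nu>_def[abs_def]
    by (intro smooth_on_scaleR smooth_on_inverse open_W smooth_s smooth_\<nu>0 s_nonzero)
  show "\<nu> u \<bullet> frechet_derivative F (at u) a = 0" if "u \<in> W" for u a
    using \<nu>0_tangent[OF that] by (simp add: \<nu>_def)
  show "\<nu> u \<bullet> \<xi> u = 1" if "u \<in> W" for u
    using s_nonzero[OF that] by (simp add: \<nu>_def s_def)
qed (rule immersed normal)+

text \<open>There are no mixed terms because n annihilates the tangent plane of the surface. At this
  stage s may still depend on the surface point.\<close>

lemma metric_eq: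
  assumes u: "u \<in> W"
  shows "C.h u a b = inverse (s u) *
    (w (u $ 1) * (a $ 1 * b $ 1) + \<epsilon> * p1 (u $ 1) * q (u $ 1) * S.h (pr23 u) (pr23 a) (pr23 b))"
  using eps
  by (simp add: C.affine_metric_eq[OF u] S.affine_metric_eq[OF inW(2)[OF u]] ddF_eq[OF u] \<nu>_def \<nu>0_def
      inner_emb inner_add_right n_\<psi> S.conormal_tangent inW[OF u] w_def algebra_simps)

lemma profile_nonzero:
  assumes u: "u \<in> W"
  shows "w (u $ 1) \<noteq> 0" "p1 (u $ 1) \<noteq> 0" "q (u $ 1) \<noteq> 0"
proof -
  note h0 = linear_0[OF S.linear_left[OF inW(2)[OF u]]]
  have nz: "\<exists>b. C.h u (axis i 1) b \<noteq> 0" for i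
    using C.nondeg[OF u] unfolding nondegenerate_form_def by (metis axis_eq_0_iff zero_neq_one)
  show "w (u $ 1) \<noteq> 0"
    using nz[of 1] by (auto simp: metric_eq[OF u] pr23_axis h0)
  show "p1 (u $ 1) \<noteq> 0"
    using nz[of 2] by (auto simp: metric_eq[OF u] axis_def)
  show "q (u $ 1) \<noteq> 0"
    using nz[of 2] by (auto simp: metric_eq[OF u] axis_def)
qed

text \<open>Only here the volume normalization of \<open>\<xi>\<close> enters: it forces the scale \<open>s\<close> to depend on \<open>t\<close>
  alone. The tenth power avoids absolute values and roots.\<close>

lemma volume_eq:
  assumes u: "u \<in> W"
  shows "s u ^ 10 * q (u $ 1) ^ 4 = (w (u $ 1))\<^sup>2 * p1 (u $ 1) ^ 4"
proof -
  let ?e = "\<lambda>i::3. if i = 1 then 1 else if i = 2 then 2 else 3 :: 4" and ?X = "\<lambda>i::3. axis i 1 :: real^3"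
  let ?v = "pr23 u" and ?t = "u $ 1"
  let ?\<rho> = "inverse (s u)"
  note v = inW(2)[OF u]
  obtain x y where xy: "\<xi> u = emb x y" using emb_surj by blast
  have X: "C.dF u (?X 1) = emb (p1 ?t) (q1 ?t *\<^sub>R \<psi> ?v)"
    "C.dF u (?X 2) = emb 0 (q ?t *\<^sub>R S.dF ?v (axis 1 1))"
    "C.dF u (?X 3) = emb 0 (q ?t *\<^sub>R S.dF ?v (axis 2 1))"
    using linear_0[OF S.linear_dF[OF v]] by (simp_all add: dF_eq[OF u] pr23_axis) (simp_all add: axis_def)
  have su: "s u = q1 ?t * x + \<epsilon> * p1 ?t * (n ?v \<bullet> y)"
    by (simp add: s_def xy \<nu>0_def inner_emb)
  have "det (frame_matrix ?e (\<lambda>i. C.dF u (?X i)) (\<xi> u)) = (q ?t)\<^sup>2 * S.area ?v * (\<epsilon> * s u)"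
    unfolding frame_matrix_3 X xy det_emb cross_mult_left cross_mult_right S.area_conormal[OF v] su
    using eps by (simp add: n_\<psi>[OF v] algebra_simps power2_eq_square)
  moreover have "det (\<chi> i j. C.h u (?X i) (?X j)) = ?\<rho> ^ 3 * w ?t * (p1 ?t * q ?t)\<^sup>2 * S.gram_det ?v"
    using S.sym[OF v, of "axis 2 1" "axis 1 1"]
      linear_0[OF S.linear_left[OF v]] linear_0[OF S.linear_right[OF v]]
    by (simp add: det_3 metric_eq[OF u] pr23_axis S.gram_det_def) (simp add: axis_def eps_cancel algebra_simps power2_eq_square power3_eq_cube)
  ultimately have "\<bar>(q ?t)\<^sup>2 * S.area ?v * (\<epsilon> * s u)\<bar> = sqrt \<bar>?\<rho> ^ 3 * w ?t * (p1 ?t * q ?t)\<^sup>2 * S.gram_det ?v\<bar>"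
    using C.volume[OF u inj_frame_3, of ?X] by simp
  then have "\<bar>(q ?t)\<^sup>2 * S.area ?v * (\<epsilon> * s u)\<bar>\<^sup>2 = \<bar>?\<rho> ^ 3 * w ?t * (p1 ?t * q ?t)\<^sup>2 * S.gram_det ?v\<bar>"
    by simp
  \<comment> \<open>The volume condition of the surface itself turns its Gram determinant into the
    squared area, which then cancels; apart from s, only functions of t remain.\<close>
  then have "((q ?t)\<^sup>2 * S.area ?v * (\<epsilon> * s u))\<^sup>2 = \<bar>?\<rho> ^ 3 * w ?t * (p1 ?t * q ?t)\<^sup>2\<bar> * (S.area ?v)\<^sup>2"
    unfolding power2_abs abs_mult[of _ "S.gram_det ?v"] S.area_square[OF v] .
  then have "((q ?t)\<^sup>2 * (\<epsilon> * s u))\<^sup>2 = \<bar>?\<rho> ^ 3 * w ?t * (p1 ?t * q ?t)\<^sup>2\<bar>"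
    using S.area_nonzero[OF v] by (simp add: power_mult_distrib)
  then have "(((q ?t)\<^sup>2 * (\<epsilon> * s u))\<^sup>2)\<^sup>2 = (?\<rho> ^ 3 * w ?t * (p1 ?t * q ?t)\<^sup>2)\<^sup>2"
    by simp
  moreover have "\<epsilon> ^ 4 = 1" using eps by (simp add: eval_nat_numeral)
  ultimately have "q ?t ^ 8 * s u ^ 4 = ?\<rho> ^ 6 * (w ?t)\<^sup>2 * p1 ?t ^ 4 * q ?t ^ 4"
    by (simp add: power_mult_distrib flip: power_mult)
  then have "s u ^ 6 * (q ?t ^ 8 * s u ^ 4) = s u ^ 6 * ?\<rho> ^ 6 * ((w ?t)\<^sup>2 * p1 ?t ^ 4 * q ?t ^ 4)"
    by simp
  moreover have "s u ^ 6 * ?\<rho> ^ 6 = 1"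
    using s_nonzero[OF u] by (simp flip: power_mult_distrib)
  ultimately have "q ?t ^ 4 * (s u ^ 10 * q ?t ^ 4) = q ?t ^ 4 * ((w ?t)\<^sup>2 * p1 ?t ^ 4)"
    by (simp add: algebra_simps flip: power_add)
  then show ?thesis using profile_nonzero(3)[OF u] by simp
qed

text \<open>In a direction with first coordinate 0 the derivative of \<open>volume_eq\<close>
  reduces to 10 s^9 q^4 ds = 0, and s and q do not vanish. Hence ds is a multiple of the first
  coordinate.\<close>

lemma ds_eq:
  assumes u: "u \<in> W"
  shows "frechet_derivative s (at u) a = a $ 1 * frechet_derivative s (at u) (axis 1 1)"
proof -
  let ?d = "frechet_derivative s (at u)"
  note ds = smooth_on_has_derivative[OF smooth_s u]
  have lin: "linear ?d" using ds has_derivative_linear by blast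
  define Q where "Q t = w t * w t * (p1 t * p1 t * (p1 t * p1 t))" for t
  define B where "B t = q t * q t * (q t * q t)" for t
  have w: "smooth_on I w"
    unfolding w_def[abs_def] by (intro smooth_on_diff smooth_on_mult open_I smooth_p123 smooth_q123)
  have Q: "smooth_on I Q" and B: "smooth_on I B"
    unfolding Q_def[abs_def] B_def[abs_def] by (intro smooth_on_mult open_I smooth_p123 smooth_q123 w)+
  have "s v ^ 10 * B (v $ 1) = Q (v $ 1)" if "v \<in> W" for v
    using volume_eq[OF that] by (simp add: Q_def B_def eval_nat_numeral mult.assoc)
  then have "((\<lambda>v. s v ^ 10 * B (v $ 1)) has_derivative (\<lambda>a. a $ 1 * deriv Q (u $ 1))) (at u)"
    using has_derivative_transform_within_open[OF has_derivative_profile[OF u Q] open_W u] by simp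
  from has_derivative_unique[OF this has_derivative_mult[OF has_derivative_power[OF ds] has_derivative_profile[OF u B]]]
  have "?d b = 0" if "b $ 1 = 0" for b
    using that s_nonzero[OF u] profile_nonzero(3)[OF u] by (auto simp: fun_eq_iff B_def dest: spec[of _ b])
  from this[of "a - a $ 1 *\<^sub>R axis 1 1"] show ?thesis
    by (simp add: linear_diff[OF lin] linear_cmul[OF lin])
qed

text \<open>Here r is the t-derivative of 1/s. The point is the factor \<open>a $ 1\<close> before
  r: along the surface the change of scale contributes nothing.\<close>

lemma d\<nu>_eq:
  assumes u: "u \<in> W"
  shows "\<exists>r. \<forall>a. C.d\<nu> u a = (a $ 1 * r) *\<^sub>R \<nu>0 u + inverse (s u) *\<^sub>R
    emb (a $ 1 * q2 (u $ 1)) ((\<epsilon> * (a $ 1 * p2 (u $ 1))) *\<^sub>R n (pr23 u) + (\<epsilon> * p1 (u $ 1)) *\<^sub>R S.d\<nu> (pr23 u) (pr23 a))"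
proof -
  have 0: "(\<nu>0 has_derivative (\<lambda>a. emb (a $ 1 * q2 (u $ 1))
      ((\<epsilon> * (a $ 1 * p2 (u $ 1))) *\<^sub>R n (pr23 u) + (\<epsilon> * p1 (u $ 1)) *\<^sub>R S.d\<nu> (pr23 u) (pr23 a)))) (at u)"
    unfolding \<nu>0_def[abs_def]
    by (rule has_derivative_eq_rhs[OF has_derivative_emb[OF has_derivative_profile[OF u smooth_q123(2)]
          has_derivative_scaleR[OF has_derivative_mult_right[OF has_derivative_profile[OF u smooth_p123(2)]]
            has_derivative_base[OF u S.smooth_conormal]]]])
       (simp add: fun_eq_iff emb_eq_iff algebra_simps)
  have i: "((\<lambda>v. inverse (s v)) has_derivative
      (\<lambda>a. - (inverse (s u) * frechet_derivative s (at u) a * inverse (s u)))) (at u)"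
    by (rule Deriv.has_derivative_inverse[OF s_nonzero[OF u] smooth_on_has_derivative[OF smooth_s u]])
  show ?thesis
    unfolding \<nu>_def[abs_def] frechet_derivative_eqI[OF has_derivative_scaleR[OF i 0]]
    by (rule exI[of _ "- (inverse (s u) * frechet_derivative s (at u) (axis 1 1) * inverse (s u))"],
        intro allI, subst ds_eq[OF u])
       (simp add: algebra_simps)
qed

text \<open>Terms with exactly two t-slots vanish, since n annihilates tangent vectors of the
  surface and its derivative annihilates \<psi>. With one t-slot only the metric of the surface
  appears, because D n(a) \<bullet> D\<psi>(b) is its negative.\<close>

lemma cubic_warped:
  assumes u: "u \<in> W"
  shows "\<exists>A B. \<forall>a b c. C.cubic u a b c = A * (a $ 1 * b $ 1 * c $ 1) +
    B * (a $ 1 * S.h (pr23 u) (pr23 b) (pr23 c) + b $ 1 * S.h (pr23 u) (pr23 a) (pr23 c)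
      + c $ 1 * S.h (pr23 u) (pr23 a) (pr23 b)) +
    inverse (s u) * \<epsilon> * p1 (u $ 1) * q (u $ 1) * S.cubic (pr23 u) (pr23 a) (pr23 b) (pr23 c)"
proof -
  let ?v = "pr23 u" and ?t = "u $ 1"
  let ?\<rho> = "inverse (s u)"
  note v = inW(2)[OF u]
  obtain r where r: "\<And>a. C.d\<nu> u a = (a $ 1 * r) *\<^sub>R \<nu>0 u + ?\<rho> *\<^sub>R
    emb (a $ 1 * q2 ?t) ((\<epsilon> * (a $ 1 * p2 ?t)) *\<^sub>R n ?v + (\<epsilon> * p1 ?t) *\<^sub>R S.d\<nu> ?v (pr23 a))"
    using d\<nu>_eq[OF u] by auto
  have h: "S.h ?v (pr23 a) (pr23 b) = n ?v \<bullet> S.ddF ?v (pr23 a) (pr23 b)" for a b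
    by (rule S.affine_metric_eq[OF v])
  note n = n_\<psi>[OF v] dn_\<psi>[OF v] S.conormal_tangent[OF v] S.dconormal_dF[OF v]
  have d\<nu>_ddF: "C.d\<nu> u a \<bullet> C.ddF u b c =
      (a $ 1 * r) * (w ?t * (b $ 1 * c $ 1) + \<epsilon> * p1 ?t * q ?t * S.h ?v (pr23 b) (pr23 c)) +
      ?\<rho> * (a $ 1 * b $ 1 * c $ 1 * (q2 ?t * p2 ?t - p2 ?t * q2 ?t) + \<epsilon> * a $ 1 * p2 ?t * q ?t * S.h ?v (pr23 b) (pr23 c)
        - \<epsilon> * p1 ?t * q1 ?t * (c $ 1 * S.h ?v (pr23 a) (pr23 b) + b $ 1 * S.h ?v (pr23 a) (pr23 c))
        + \<epsilon> * p1 ?t * q ?t * (S.d\<nu> ?v (pr23 a) \<bullet> S.ddF ?v (pr23 b) (pr23 c)))" for a b c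
    unfolding r ddF_eq[OF u] \<nu>0_def h w_def
    by (simp add: inner_emb inner_add_left inner_add_right n eps_cancel algebra_simps)
  have \<nu>_dddF: "\<nu> u \<bullet> C.dddF u a b c = ?\<rho> * (a $ 1 * b $ 1 * c $ 1 * (q1 ?t * p3 ?t - p1 ?t * q3 ?t)
      + \<epsilon> * p1 ?t * q1 ?t * (c $ 1 * S.h ?v (pr23 a) (pr23 b) + b $ 1 * S.h ?v (pr23 a) (pr23 c) + a $ 1 * S.h ?v (pr23 b) (pr23 c))
      + \<epsilon> * p1 ?t * q ?t * (n ?v \<bullet> S.dddF ?v (pr23 a) (pr23 b) (pr23 c)))" for a b c
    unfolding dddF_eq[OF u] \<nu>_def \<nu>0_def h
    by (simp add: inner_emb inner_add_left inner_add_right n eps_cancel algebra_simps)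
  show ?thesis
    unfolding C.cubic_def S.cubic_def d\<nu>_ddF \<nu>_dddF
    \<comment> \<open>The factor 3 in 3 r w counts one scale term per slot. In the second witness,
      -p1 q1 is one such term from the third derivative of F minus two from the derivatives of the
      conormal.\<close>
    by (rule exI[of _ "?\<rho> * (q1 ?t * p3 ?t - p1 ?t * q3 ?t) + 3 * r * w ?t"],
        rule exI[of _ "\<epsilon> * (r * p1 ?t * q ?t + ?\<rho> * p2 ?t * q ?t - ?\<rho> * p1 ?t * q1 ?t)"])
       (use S.sym[OF v] in \<open>simp add: algebra_simps\<close>)
qed

lemma order_three_symmetry_at:
  assumes u: "u \<in> W" and pos: "positive_definite_form (S.h (pr23 u))"
  shows "\<exists>S. subgroup S (special_isometry_group (C.h u)) \<and>
    special_isometry_group (C.h u)\<lparr>carrier := S\<rparr> \<cong> integer_mod_group 3 \<and>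
    (\<forall>L\<in>S. \<forall>x y. difference_tensor W F \<xi> u (L x) (L y) = L (difference_tensor W F \<xi> u x y))"
proof -
  let ?v = "pr23 u" and ?e = "axis 1 1 :: real^2" and ?f = "axis 2 1 :: real^2"
  note v = inW(2)[OF u]
  define a b c where "a = S.h ?v ?e ?e" and "b = S.h ?v ?e ?f" and "c = S.h ?v ?f ?f"
  have h2: "S.h ?v (pr23 x) (pr23 y) = plane_form a b c x y" for x y
    using S.h_expansion[OF v, of "pr23 x" "pr23 y"] by (simp add: plane_form_def a_def b_def c_def)
  have a: "a > 0" using pos by (simp add: a_def positive_definite_form_def axis_eq_0_iff)
  \<comment> \<open>This vector is orthogonal to the first axis, and its square is a (a c -
    b^2).\<close>
  have "vector [- b, a] \<noteq> (0 :: real^2)" using a by (auto simp: vec_eq_iff forall_2)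
  then have "S.h ?v (vector [- b, a]) (vector [- b, a]) > 0"
    using pos by (simp add: positive_definite_form_def)
  then have "a * (a * c - b\<^sup>2) > 0"
    using S.h_expansion[OF v, of "vector [- b, a]" "vector [- b, a]"]
    by (simp add: a_def[symmetric] b_def[symmetric] c_def[symmetric] algebra_simps power2_eq_square)
  then have det: "a * c - b\<^sup>2 > 0" using a by (simp add: zero_less_mult_iff)
  define k where "k x y z = S.cubic ?v x y z" for x y z
  have cubic2: "S.cubic ?v (pr23 x) (pr23 y) (pr23 z) =
      plane_cubic (k ?e ?e ?e) (k ?e ?e ?f) (k ?e ?f ?f) (k ?f ?f ?f) x y z" for x y z
    using S.cubic_expansion[OF v, of "pr23 x" "pr23 y" "pr23 z"] by (simp add: plane_cubic_def k_def)
  have trace: "c * k ?e ?e ?e - 2 * b * k ?e ?e ?f + a * k ?e ?f ?f = 0"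
      "c * k ?e ?e ?f - 2 * b * k ?e ?f ?f + a * k ?f ?f ?f = 0"
  proof -
    have "k ?f ?e ?e = k ?e ?e ?f" "k ?f ?e ?f = k ?e ?f ?f"
      unfolding k_def using S.cubic_commute[OF v] by metis+
    then show "c * k ?e ?e ?e - 2 * b * k ?e ?e ?f + a * k ?e ?f ?f = 0"
      "c * k ?e ?e ?f - 2 * b * k ?e ?f ?f + a * k ?f ?f ?f = 0"
      using S.cubic_trace[OF v, of ?e] S.cubic_trace[OF v, of ?f]
      by (simp_all add: a_def b_def c_def k_def)
  qed
  obtain A B where cub: "\<And>x y z. C.cubic u x y z = A * (x $ 1 * y $ 1 * z $ 1) +
      B * (x $ 1 * S.h ?v (pr23 y) (pr23 z) + y $ 1 * S.h ?v (pr23 x) (pr23 z) + z $ 1 * S.h ?v (pr23 x) (pr23 y)) +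
      inverse (s u) * \<epsilon> * p1 (u $ 1) * q (u $ 1) * S.cubic ?v (pr23 x) (pr23 y) (pr23 z)"
    using cubic_warped[OF u] by auto
  show ?thesis
  proof (rule order_three_symmetry[OF det _ C.nondeg[OF u] _ trace])
    show "C.h u x y = (inverse (s u) * w (u $ 1)) * (x $ 1 * y $ 1) +
        (inverse (s u) * \<epsilon> * p1 (u $ 1) * q (u $ 1)) * plane_form a b c x y" for x y
      unfolding metric_eq[OF u] h2 by (simp add: algebra_simps)
    show "C.h u (difference_tensor W F \<xi> u x y) z = (- A / 2) * (x $ 1 * y $ 1 * z $ 1) +
        (- B / 2) * (x $ 1 * plane_form a b c y z + y $ 1 * plane_form a b c x z + z $ 1 * plane_form a b c x y) +
        (- (inverse (s u) * \<epsilon> * p1 (u $ 1) * q (u $ 1)) / 2) *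
          plane_cubic (k ?e ?e ?e) (k ?e ?e ?f) (k ?e ?f ?f) (k ?f ?f ?f) x y z" for x y z
      unfolding C.difference_tensor_cubic[OF u] cub h2 cubic2
      by (simp add: add_divide_distrib diff_divide_distrib)
  qed
qed

end

section \<open>From product charts to the manifold\<close>

theorem theorem3:
  fixes T :: "'p topology" and A :: "(2, 'p) chart set"
    and \<phi> :: "'p \<Rightarrow> real^3" and \<epsilon>\<^sub>1 :: real
    and I :: "real set" and \<gamma> :: "real \<Rightarrow> real^2"
    and \<xi> :: "real \<times> 'p \<Rightarrow> real^4" and H :: real
  assumes "smooth_manifold T A"
    and "\<epsilon>\<^sub>1 = 1 \<or> \<epsilon>\<^sub>1 = -1"
    and "affine_hypersphere A \<phi> (\<lambda>q. - (\<epsilon>\<^sub>1 *\<^sub>R \<phi> q)) \<epsilon>\<^sub>1"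
    and "metric_satisfies A \<phi> (\<lambda>q. - (\<epsilon>\<^sub>1 *\<^sub>R \<phi> q)) positive_definite_form"
    and "open I" and "is_interval I" and "smooth_on I \<gamma>"
    and "affine_hypersphere (interval_times_atlas I A) (warped_hypersurface \<gamma> \<phi>) \<xi> H"
    and "metric_satisfies (interval_times_atlas I A) (warped_hypersurface \<gamma> \<phi>) \<xi> indefinite_form"
    and "metric_satisfies (interval_times_atlas I A) (warped_hypersurface \<gamma> \<phi>) \<xi>
           (\<lambda>h. negative_index h = 1)"
  shows "\<forall>p \<in> I \<times> topspace T.
           symmetric_at (interval_times_atlas I A) (warped_hypersurface \<gamma> \<phi>) \<xi> (integer_mod_group 3) p \<or>
           symmetric_at (interval_times_atlas I A) (warped_hypersurface \<gamma> \<phi>) \<xi> SO2 p"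
proof (rule ballI, rule disjI1)
  fix pt assume "pt \<in> I \<times> topspace T"
  then obtain t y where pt: "pt = (t, y)" and t: "t \<in> I" and "y \<in> topspace T" by auto
  moreover have "(\<Union>(U, x)\<in>A. x ` U) = topspace T"
    using assms(1) by (simp add: smooth_manifold_def)
  ultimately have "y \<in> (\<Union>(U, x)\<in>A. x ` U)" by simp
  then obtain U x v where chart: "(U, x) \<in> A" and v: "v \<in> U" and y: "y = x v" by auto
  define W where "W = {u :: real^3. u $ 1 \<in> I \<and> pr23 u \<in> U}"
  define X where "X = (\<lambda>u :: real^3. (u $ 1, x (pr23 u)))"
  define F where "F = warped_hypersurface \<gamma> \<phi> \<circ> X"
  define u :: "real^3" where "u = vector [t, v $ 1, v $ 2]"
  have prod_chart: "(W, X) \<in> interval_times_atlas I A"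
    using chart by (force simp: interval_times_atlas_def W_def X_def)
  have pr: "pr23 u = v" by (simp add: u_def vec_eq_iff forall_2)
  have u: "u \<in> W" "X u = pt" using t v by (simp_all add: W_def X_def pr) (simp_all add: u_def pt y)
  have normal: "(\<lambda>q. - (\<epsilon>\<^sub>1 *\<^sub>R \<phi> q)) \<circ> x = (\<lambda>v. - (\<epsilon>\<^sub>1 *\<^sub>R (\<phi> \<circ> x) v))"
    by (simp add: fun_eq_iff)
  have "immersed_hypersurface U (\<phi> \<circ> x)" "affine_normal U (\<phi> \<circ> x) (\<lambda>v. - (\<epsilon>\<^sub>1 *\<^sub>R (\<phi> \<circ> x) v))"
    using assms(3) chart by (auto simp: affine_hypersphere_def normal)
  then obtain n where n: "conormal_surface U (\<phi> \<circ> x) (\<lambda>v. - (\<epsilon>\<^sub>1 *\<^sub>R (\<phi> \<circ> x) v)) n"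
    using surface_conormal_exists by blast
  have F: "immersed_hypersurface W F" "affine_normal W F (\<xi> \<circ> X)"
    using assms(8) prod_chart by (auto simp: affine_hypersphere_def F_def)
  have "warped U (\<phi> \<circ> x) n \<epsilon>\<^sub>1 I (\<lambda>t. \<gamma> t $ 1) (\<lambda>t. \<gamma> t $ 2) (\<xi> \<circ> X) W F"
  proof (rule warped.intro[OF _ n])
    show "\<epsilon>\<^sub>1 * \<epsilon>\<^sub>1 = 1" using assms(2) by auto
    show "smooth_on I (\<lambda>t. \<gamma> t $ 1)" "smooth_on I (\<lambda>t. \<gamma> t $ 2)"
      by (intro smooth_on_component assms(5,7))+
    show "F = (\<lambda>u. emb (\<gamma> (u $ 1) $ 1) (\<gamma> (u $ 1) $ 2 *\<^sub>R (\<phi> \<circ> x) (pr23 u)))"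
      by (simp add: fun_eq_iff F_def X_def warped_hypersurface_def emb_def)
  qed (use assms(5) F W_def in auto)
  moreover have "positive_definite_form (affine_metric (\<phi> \<circ> x) (\<lambda>v. - (\<epsilon>\<^sub>1 *\<^sub>R (\<phi> \<circ> x) v)) (pr23 u))"
    using assms(4) chart v by (auto simp: metric_satisfies_def normal pr)
  ultimately have "\<exists>S. subgroup S (special_isometry_group (affine_metric F (\<xi> \<circ> X) u)) \<and>
      special_isometry_group (affine_metric F (\<xi> \<circ> X) u)\<lparr>carrier := S\<rparr> \<cong> integer_mod_group 3 \<and>
      (\<forall>L\<in>S. \<forall>a b. difference_tensor W F (\<xi> \<circ> X) u (L a) (L b) = L (difference_tensor W F (\<xi> \<circ> X) u a b))"
    using u(1) by (intro warped.order_three_symmetry_at)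
  then show "symmetric_at (interval_times_atlas I A) (warped_hypersurface \<gamma> \<phi>) \<xi> (integer_mod_group 3) pt"
    unfolding symmetric_at_def Let_def F_def using prod_chart u by blast
qed

end
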